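(* Let $C_2=\{1,\omega\}$ with $\omega^2=1$, let $G=S^1\times C_2$ with componentwise multiplication, and let $\theta:G\to G$ be the involutive automorphism $\theta(z,1)=(z,1)$, $\theta(z,\omega)=(-z,\omega)$. Let $\mathcal C$ be the one-object dagger simplicial category with $\mathcal C(\ast,\ast)=\mathrm{Sing}(G)$ (composition given by multiplication in $G$) and $g^\dagger:=\theta(g^{-1})$. Then $u:=(1,\omega)$ is weakly unitary, but $[u]$ is not coherently unitary.
   Context: A dagger simplicial category is a small simplicial category $\mathcal C$ with simplicial maps $(-)^\dagger:\mathcal C(x,y)\to\mathcal C(y,x)$ with $(f^\dagger)^\dagger=f$, $\mathrm{id}_x^\dagger=\mathrm{id}_x$, $(gf)^\dagger=f^\dagger g^\dagger$; morphisms in $\mathrm{sCat}^\dagger$ (dagger simplicial functors) are simplicial functors commuting with daggers. The homotopy category $\mathrm h\mathcal C$, with hom-sets $\pi_0\mathcal C(x,y)$, inherits a dagger. An isomorphism $[u]$ of $\mathrm h\mathcal C$ is weakly unitary if $[u]^\dagger=[u]^{-1}$. For a set $O$, $\mathrm{sCat}^\dagger_O$ has objects the dagger simplicial categories with object set $O$ and morphisms that are the identity on $O$. It carries the fixed-object model structure whose weak equivalences (local weak equivalences) and fibrations are the maps that are weak homotopy equivalences, resp. Kan fibrations, on all mapping spaces; its cofibrations are the maps with the left lifting property against morphisms of $\mathrm{sCat}^\dagger_O$ that are trivial Kan fibrations on all mapping spaces. $\mathbb J_\dagger$: the dagger category with objects $0,1$ freely generated by $a:0\to1$ and $a^\dagger$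 (no relations). $\mathbb I_\dagger$: the dagger category with objects $0,1$ generated by $u:0\to1$, $u^\dagger$ with $u^\dagger u=\mathrm{id}_0$, $uu^\dagger=\mathrm{id}_1$. Both are regarded as having discrete mapping spaces; $q:\mathbb J_\dagger\to\mathbb I_\dagger$ is identity on objects with $q(a)=u$. A natural dagger interval is a factorization $\mathbb J_\dagger\xrightarrow{j_{\mathbb H}}\mathbb H\xrightarrow{p_{\mathbb H}}\mathbb I_\dagger$ of $q$ in $\mathrm{sCat}^\dagger_{\{0,1\}}$ with $j_{\mathbb H}$ a fixed-object cofibration, $p_{\mathbb H}$ a local weak equivalence, and all mapping spaces of $\mathbb H$ countable; $h_{\mathbb H}:=j_{\mathbb H}(a)$. For objects $x,y$ (possibly equal) of $\mathcal C$, $\mathcal C\langle x,y\rangle\in\mathrm{sCat}^\dagger_{\{0,1\}}$ has mapping spaces $\mathcal C(x_i,x_j)$ with $x_0=x,x_1=y$, with inherited composition and dagger. Fix a functorial fibrant replacement $r_\Theta:\Theta\to R\Theta$ in the fixed-object model structure on $\mathrm{sCat}^\dagger_{\{0,1\}}$ ($r_\Theta$ a trivial cofibration). The class $[u]$ of $u\in\mathcal C(x,y)_0$ is coherently unitary if there are a natural dagger interval $\mathbb H$ and a dagger simplicial functor $\Phi:\mathbb H\to R(\mathcal C\langle x,y\rangle)$ in $\mathrm{sCat}^\dagger_{\{0,1\}}$ with $[\Phi(h_{\mathbb H})]=[r(u)]$ in $\pi_0R(\mathcal C\langle x,y\rangle)(0,1)$. *)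

theory Defs
  imports "HOL-Homology.Homology"
begin

section \<open>Simplicial sets\<close>

text \<open>\<open>Delta m n\<close> is the set of morphisms from \<open>[m]\<close> to \<open>[n]\<close> in the simplex category; composition is
  \<^const>\<open>compose\<close>.\<close>

definition Delta :: "nat \<Rightarrow> nat \<Rightarrow> (nat \<Rightarrow> nat) set" where
  "Delta m n = {\<alpha> \<in> {..m} \<rightarrow>\<^sub>E {..n}. mono_on {..m} \<alpha>}"

definition const_op :: "nat \<Rightarrow> nat \<Rightarrow> nat \<Rightarrow> nat" where
  "const_op m i = (\<lambda>_\<in>{..m}. i)"

text \<open>\<open>act X m n \<alpha>\<close> is the map from \<open>n\<close>-simplices to \<open>m\<close>-simplices induced by \<open>\<alpha> \<in> Delta m n\<close>.\<close>

record 'a sset =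
  simplices :: "nat \<Rightarrow> 'a set"
  act :: "nat \<Rightarrow> nat \<Rightarrow> (nat \<Rightarrow> nat) \<Rightarrow> 'a \<Rightarrow> 'a"

locale simplicial_set =
  fixes X :: "'a sset"
  assumes act_closed: "\<lbrakk>\<alpha> \<in> Delta m n; s \<in> simplices X n\<rbrakk> \<Longrightarrow> act X m n \<alpha> s \<in> simplices X m"
    and act_id: "s \<in> simplices X n \<Longrightarrow> act X n n (\<lambda>i\<in>{..n}. i) s = s"
    and act_compose: "\<lbrakk>\<alpha> \<in> Delta m n; \<beta> \<in> Delta l m; s \<in> simplices X n\<rbrakk>
      \<Longrightarrow> act X l n (compose {..l} \<alpha> \<beta>) s = act X l m \<beta> (act X m n \<alpha> s)"

definition smap :: "'a sset \<Rightarrow> 'b sset \<Rightarrow> (nat \<Rightarrow> 'a \<Rightarrow> 'b) \<Rightarrow> bool" where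
  "smap X Y f \<longleftrightarrow>
     (\<forall>n. \<forall>s\<in>simplices X n. f n s \<in> simplices Y n) \<and>
     (\<forall>m n. \<forall>\<alpha>\<in>Delta m n. \<forall>s\<in>simplices X n. f m (act X m n \<alpha> s) = act Y m n \<alpha> (f n s))"

definition smap_eq :: "'a sset \<Rightarrow> (nat \<Rightarrow> 'a \<Rightarrow> 'b) \<Rightarrow> (nat \<Rightarrow> 'a \<Rightarrow> 'b) \<Rightarrow> bool" where
  "smap_eq X f g \<longleftrightarrow> (\<forall>n. \<forall>s\<in>simplices X n. f n s = g n s)"

definition std_sset :: "nat \<Rightarrow> (nat \<Rightarrow> nat) sset" where
  "std_sset n = \<lparr>simplices = (\<lambda>m. Delta m n), act = (\<lambda>l m \<alpha> \<beta>. compose {..l} \<beta> \<alpha>)\<rparr>"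

definition horn :: "nat \<Rightarrow> nat \<Rightarrow> (nat \<Rightarrow> nat) sset" where
  "horn n k = std_sset n
     \<lparr>simplices := (\<lambda>m. {\<beta> \<in> Delta m n. \<exists>i\<le>n. i \<noteq> k \<and> i \<notin> \<beta> ` {..m}})\<rparr>"

definition kan_fibration :: "'a sset \<Rightarrow> 'b sset \<Rightarrow> (nat \<Rightarrow> 'a \<Rightarrow> 'b) \<Rightarrow> bool" where
  "kan_fibration E B p \<longleftrightarrow> smap E B p \<and>
     (\<forall>n\<ge>1. \<forall>k\<le>n. \<forall>f g. smap (horn n k) E f \<and> smap (std_sset n) B g \<and>
        smap_eq (horn n k) (\<lambda>m s. p m (f m s)) g \<longrightarrow>
        (\<exists>h. smap (std_sset n) E h \<and> smap_eq (horn n k) h f \<and>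
             smap_eq (std_sset n) (\<lambda>m s. p m (h m s)) g))"

definition discrete_sset :: "'a set \<Rightarrow> 'a sset" where
  "discrete_sset M = \<lparr>simplices = (\<lambda>_. M), act = (\<lambda>_ _ _ s. s)\<rparr>"

definition pi0_class :: "'a sset \<Rightarrow> 'a \<Rightarrow> 'a set" where
  "pi0_class X s = {t \<in> simplices X 0. equivclp (\<lambda>a b. \<exists>e\<in>simplices X 1.
      a = act X 0 1 (const_op 0 0) e \<and> b = act X 0 1 (const_op 0 1) e) s t}"

definition pi0 :: "'a sset \<Rightarrow> 'a set set" where
  "pi0 X = pi0_class X ` simplices X 0"


section \<open>Geometric realization and weak homotopy equivalences\<close>

definition simplex_top :: "nat \<Rightarrow> (nat \<Rightarrow> real) topology" where
  "simplex_top n = subtopology (powertop_real UNIV) (standard_simplex n)"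

definition push_coords :: "nat \<Rightarrow> (nat \<Rightarrow> nat) \<Rightarrow> (nat \<Rightarrow> real) \<Rightarrow> nat \<Rightarrow> real" where
  "push_coords m \<alpha> t = (\<lambda>j. \<Sum>i | i \<le> m \<and> \<alpha> i = j. t i)"

definition cells_top :: "'a sset \<Rightarrow> (nat \<times> 'a \<times> (nat \<Rightarrow> real)) topology" where
  "cells_top X =
     sum_topology (\<lambda>n. prod_topology (discrete_topology (simplices X n)) (simplex_top n)) UNIV"

definition glue :: "'a sset \<Rightarrow> nat \<times> 'a \<times> (nat \<Rightarrow> real) \<Rightarrow> nat \<times> 'a \<times> (nat \<Rightarrow> real) \<Rightarrow> bool" where
  "glue X p q \<longleftrightarrow> (\<exists>m n. \<exists>\<alpha>\<in>Delta m n. \<exists>s\<in>simplices X n. \<exists>t\<in>standard_simplex m.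
     p = (m, act X m n \<alpha> s, t) \<and> q = (n, s, push_coords m \<alpha> t))"

definition real_pt ::
  "'a sset \<Rightarrow> nat \<times> 'a \<times> (nat \<Rightarrow> real) \<Rightarrow> (nat \<times> 'a \<times> (nat \<Rightarrow> real)) set" where
  "real_pt X p = {q. equivclp (glue X) p q}"

text \<open>The realization carries the quotient topology of \<^const>\<open>cells_top\<close>.\<close>

definition realization :: "'a sset \<Rightarrow> (nat \<times> 'a \<times> (nat \<Rightarrow> real)) set topology" where
  "realization X = topology (\<lambda>U. U \<subseteq> real_pt X ` topspace (cells_top X) \<and>
     openin (cells_top X) {p \<in> topspace (cells_top X). real_pt X p \<in> U})"

definition realize_map ::
  "'b sset \<Rightarrow> (nat \<Rightarrow> 'a \<Rightarrow> 'b) \<Rightarrow> (nat \<times> 'a \<times> (nat \<Rightarrow> real)) set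
   \<Rightarrow> (nat \<times> 'b \<times> (nat \<Rightarrow> real)) set" where
  "realize_map Y f c = (\<Union>(n, s, t)\<in>c. real_pt Y (n, f n s, t))"

definition cube :: "nat \<Rightarrow> (nat \<Rightarrow> real) topology" where
  "cube n = product_topology (\<lambda>_. top_of_set {0..1}) {..<n}"

definition cube_boundary :: "nat \<Rightarrow> (nat \<Rightarrow> real) set" where
  "cube_boundary n = {t \<in> topspace (cube n). \<exists>i<n. t i = 0 \<or> t i = 1}"

definition based_maps :: "nat \<Rightarrow> 'a topology \<Rightarrow> 'a \<Rightarrow> ((nat \<Rightarrow> real) \<Rightarrow> 'a) set" where
  "based_maps n X x = {f. continuous_map (cube n) X f \<and> f ` cube_boundary n \<subseteq> {x}}"

definition htpy_class ::
  "nat \<Rightarrow> 'a topology \<Rightarrow> 'a \<Rightarrow> ((nat \<Rightarrow> real) \<Rightarrow> 'a) \<Rightarrow> ((nat \<Rightarrow> real) \<Rightarrow> 'a) set" where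
  "htpy_class n X x f = {g. homotopic_with (\<lambda>h. h ` cube_boundary n \<subseteq> {x}) (cube n) X f g}"

definition htpy_group :: "nat \<Rightarrow> 'a topology \<Rightarrow> 'a \<Rightarrow> ((nat \<Rightarrow> real) \<Rightarrow> 'a) set set" where
  "htpy_group n X x = htpy_class n X x ` based_maps n X x"

text \<open>Continuity of \<open>f\<close> makes the unions below single classes. The maps induced on
  homotopy groups are automatically homomorphisms, so that it suffices to ask for bijectivity.\<close>

definition weak_equivalence_top :: "'a topology \<Rightarrow> 'b topology \<Rightarrow> ('a \<Rightarrow> 'b) \<Rightarrow> bool" where
  "weak_equivalence_top X Y f \<longleftrightarrow> continuous_map X Y f \<and>
     bij_betw (\<lambda>c. \<Union>x\<in>c. path_component_of_set Y (f x))
       (path_components_of X) (path_components_of Y) \<and>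
     (\<forall>n\<ge>1. \<forall>x\<in>topspace X.
        bij_betw (\<lambda>c. \<Union>g\<in>c. htpy_class n Y (f x) (f \<circ> g)) (htpy_group n X x) (htpy_group n Y (f x)))"

definition weak_equivalence :: "'a sset \<Rightarrow> 'b sset \<Rightarrow> (nat \<Rightarrow> 'a \<Rightarrow> 'b) \<Rightarrow> bool" where
  "weak_equivalence X Y f \<longleftrightarrow> smap X Y f \<and>
     weak_equivalence_top (realization X) (realization Y) (realize_map Y f)"

definition trivial_kan_fibration :: "'a sset \<Rightarrow> 'b sset \<Rightarrow> (nat \<Rightarrow> 'a \<Rightarrow> 'b) \<Rightarrow> bool" where
  "trivial_kan_fibration E B p \<longleftrightarrow> kan_fibration E B p \<and> weak_equivalence E B p"


section \<open>Dagger simplicial categories\<close>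

text \<open>\<open>cmp C x y z n g f\<close> is the composite of the \<open>n\<close>-simplices \<open>g\<close> of \<open>C(y,z)\<close> and \<open>f\<close> of \<open>C(x,y)\<close>;
  \<open>dag C x y n\<close> is the dagger on \<open>n\<close>-simplices from \<open>C(x,y)\<close> to \<open>C(y,x)\<close>. Smallness is expressed by
  the types: \<open>'o\<close> and \<open>'a\<close> are the universes of objects and of simplices.\<close>

record ('o, 'a) dscat =
  obj :: "'o set"
  maps :: "'o \<Rightarrow> 'o \<Rightarrow> 'a sset"
  cmp :: "'o \<Rightarrow> 'o \<Rightarrow> 'o \<Rightarrow> nat \<Rightarrow> 'a \<Rightarrow> 'a \<Rightarrow> 'a"
  idm :: "'o \<Rightarrow> 'a"
  dag :: "'o \<Rightarrow> 'o \<Rightarrow> nat \<Rightarrow> 'a \<Rightarrow> 'a"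

abbreviation mor :: "('o, 'a) dscat \<Rightarrow> 'o \<Rightarrow> 'o \<Rightarrow> nat \<Rightarrow> 'a set" where
  "mor C x y n \<equiv> simplices (maps C x y) n"

definition idn :: "('o, 'a) dscat \<Rightarrow> 'o \<Rightarrow> nat \<Rightarrow> 'a" where
  "idn C x n = act (maps C x x) n 0 (const_op n 0) (idm C x)"

locale dagger_scat =
  fixes C :: "('o, 'a) dscat"
  assumes maps_sset: "\<lbrakk>x \<in> obj C; y \<in> obj C\<rbrakk> \<Longrightarrow> simplicial_set (maps C x y)"
    and cmp_closed: "\<lbrakk>x \<in> obj C; y \<in> obj C; z \<in> obj C; g \<in> mor C y z n; f \<in> mor C x y n\<rbrakk>
      \<Longrightarrow> cmp C x y z n g f \<in> mor C x z n"
    and cmp_act: "\<lbrakk>x \<in> obj C; y \<in> obj C; z \<in> obj C; \<alpha> \<in> Delta m n; g \<in> mor C y z n; f \<in> mor C x y n\<rbrakk>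
      \<Longrightarrow> act (maps C x z) m n \<alpha> (cmp C x y z n g f)
          = cmp C x y z m (act (maps C y z) m n \<alpha> g) (act (maps C x y) m n \<alpha> f)"
    and cmp_assoc: "\<lbrakk>w \<in> obj C; x \<in> obj C; y \<in> obj C; z \<in> obj C;
        h \<in> mor C y z n; g \<in> mor C x y n; f \<in> mor C w x n\<rbrakk>
      \<Longrightarrow> cmp C w y z n h (cmp C w x y n g f) = cmp C w x z n (cmp C x y z n h g) f"
    and idm_closed: "x \<in> obj C \<Longrightarrow> idm C x \<in> mor C x x 0"
    and cmp_id_left: "\<lbrakk>x \<in> obj C; y \<in> obj C; f \<in> mor C x y n\<rbrakk> \<Longrightarrow> cmp C x y y n (idn C y n) f = f"
    and cmp_id_right: "\<lbrakk>x \<in> obj C; y \<in> obj C; f \<in> mor C x y n\<rbrakk> \<Longrightarrow> cmp C x x y n f (idn C x n) = f"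
    and dag_smap: "\<lbrakk>x \<in> obj C; y \<in> obj C\<rbrakk> \<Longrightarrow> smap (maps C x y) (maps C y x) (dag C x y)"
    and dag_dag: "\<lbrakk>x \<in> obj C; y \<in> obj C; f \<in> mor C x y n\<rbrakk>
      \<Longrightarrow> dag C y x n (dag C x y n f) = f"
    and dag_idm: "x \<in> obj C \<Longrightarrow> dag C x x 0 (idm C x) = idm C x"
    and dag_cmp: "\<lbrakk>x \<in> obj C; y \<in> obj C; z \<in> obj C; g \<in> mor C y z n; f \<in> mor C x y n\<rbrakk>
      \<Longrightarrow> dag C x z n (cmp C x y z n g f) = cmp C z y x n (dag C x y n f) (dag C y z n g)"

definition sCat :: "'o set \<Rightarrow> ('o, 'a) dscat set" where
  "sCat Obs = {C. dagger_scat C \<and> obj C = Obs}"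

type_synonym ('o, 'a, 'b) dmor = "'o \<Rightarrow> 'o \<Rightarrow> nat \<Rightarrow> 'a \<Rightarrow> 'b"

text \<open>Dagger simplicial functors that are the identity on objects.\<close>

locale dagger_functor = A: dagger_scat A + B: dagger_scat B
  for A :: "('o, 'a) dscat" and B :: "('o, 'b) dscat" and F :: "('o, 'a, 'b) dmor" +
  assumes obj_eq: "obj A = obj B"
    and F_smap: "\<lbrakk>x \<in> obj A; y \<in> obj A\<rbrakk> \<Longrightarrow> smap (maps A x y) (maps B x y) (F x y)"
    and F_cmp: "\<lbrakk>x \<in> obj A; y \<in> obj A; z \<in> obj A; g \<in> mor A y z n; f \<in> mor A x y n\<rbrakk>
      \<Longrightarrow> F x z n (cmp A x y z n g f) = cmp B x y z n (F y z n g) (F x y n f)"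
    and F_idm: "x \<in> obj A \<Longrightarrow> F x x 0 (idm A x) = idm B x"
    and F_dag: "\<lbrakk>x \<in> obj A; y \<in> obj A; f \<in> mor A x y n\<rbrakk>
      \<Longrightarrow> F y x n (dag A x y n f) = dag B x y n (F x y n f)"

definition dmor_eq :: "('o, 'a) dscat \<Rightarrow> ('o, 'a, 'b) dmor \<Rightarrow> ('o, 'a, 'b) dmor \<Rightarrow> bool" where
  "dmor_eq A F G \<longleftrightarrow> (\<forall>x\<in>obj A. \<forall>y\<in>obj A. smap_eq (maps A x y) (F x y) (G x y))"

definition dmor_id :: "('o, 'a, 'a) dmor" where
  "dmor_id = (\<lambda>x y n s. s)"

definition dmor_comp :: "('o, 'b, 'c) dmor \<Rightarrow> ('o, 'a, 'b) dmor \<Rightarrow> ('o, 'a, 'c) dmor" where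
  "dmor_comp G F = (\<lambda>x y n s. G x y n (F x y n s))"

definition discrete_dscat ::
  "'o set \<Rightarrow> ('o \<Rightarrow> 'o \<Rightarrow> 'a set) \<Rightarrow> ('o \<Rightarrow> 'o \<Rightarrow> 'o \<Rightarrow> 'a \<Rightarrow> 'a \<Rightarrow> 'a) \<Rightarrow> ('o \<Rightarrow> 'a)
   \<Rightarrow> ('o \<Rightarrow> 'o \<Rightarrow> 'a \<Rightarrow> 'a) \<Rightarrow> ('o, 'a) dscat" where
  "discrete_dscat Obs M c i d =
     \<lparr>obj = Obs, maps = (\<lambda>x y. discrete_sset (M x y)), cmp = (\<lambda>x y z n. c x y z),
      idm = i, dag = (\<lambda>x y n. d x y)\<rparr>"


section \<open>The fixed-object model structure\<close>

definition local_weak_equivalence ::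
  "('o, 'a) dscat \<Rightarrow> ('o, 'b) dscat \<Rightarrow> ('o, 'a, 'b) dmor \<Rightarrow> bool" where
  "local_weak_equivalence A B F \<longleftrightarrow> dagger_functor A B F \<and>
     (\<forall>x\<in>obj A. \<forall>y\<in>obj A. weak_equivalence (maps A x y) (maps B x y) (F x y))"

definition local_fibration ::
  "('o, 'a) dscat \<Rightarrow> ('o, 'b) dscat \<Rightarrow> ('o, 'a, 'b) dmor \<Rightarrow> bool" where
  "local_fibration A B F \<longleftrightarrow> dagger_functor A B F \<and>
     (\<forall>x\<in>obj A. \<forall>y\<in>obj A. kan_fibration (maps A x y) (maps B x y) (F x y))"

definition local_trivial_fibration ::
  "('o, 'a) dscat \<Rightarrow> ('o, 'b) dscat \<Rightarrow> ('o, 'a, 'b) dmor \<Rightarrow> bool" where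
  "local_trivial_fibration A B F \<longleftrightarrow> dagger_functor A B F \<and>
     (\<forall>x\<in>obj A. \<forall>y\<in>obj A. trivial_kan_fibration (maps A x y) (maps B x y) (F x y))"

text \<open>The test maps \<open>P\<close> range over the universe \<open>'u\<close> of the codomain of \<open>F\<close>. By the small object
  argument and the retract argument, the resulting notion does not depend on the choice of
  an infinite universe containing \<open>A\<close> and \<open>B\<close>.\<close>

definition cofibration ::
  "('o, 'a) dscat \<Rightarrow> ('o, 'u) dscat \<Rightarrow> ('o, 'a, 'u) dmor \<Rightarrow> bool" where
  "cofibration A B F \<longleftrightarrow> dagger_functor A B F \<and>
     (\<forall>(E :: ('o, 'u) dscat) (D :: ('o, 'u) dscat) P f g.
        local_trivial_fibration E D P \<and> dagger_functor A E f \<and> dagger_functor B D g \<and>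
        dmor_eq A (dmor_comp P f) (dmor_comp g F) \<longrightarrow>
        (\<exists>h. dagger_functor B E h \<and> dmor_eq A (dmor_comp h F) f \<and> dmor_eq B (dmor_comp P h) g))"

definition terminal_dscat :: "'o set \<Rightarrow> ('o, unit) dscat" where
  "terminal_dscat Obs =
     discrete_dscat Obs (\<lambda>_ _. {()}) (\<lambda>_ _ _ _ _. ()) (\<lambda>_. ()) (\<lambda>_ _ _. ())"

definition fibrant :: "('o, 'a) dscat \<Rightarrow> bool" where
  "fibrant A \<longleftrightarrow> local_fibration A (terminal_dscat (obj A)) (\<lambda>_ _ _ _. ())"

definition functorial_fibrant_replacement ::
  "'o set \<Rightarrow> (('o, 'u) dscat \<Rightarrow> ('o, 'u) dscat)
   \<Rightarrow> (('o, 'u) dscat \<Rightarrow> ('o, 'u) dscat \<Rightarrow> ('o, 'u, 'u) dmor \<Rightarrow> ('o, 'u, 'u) dmor)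
   \<Rightarrow> (('o, 'u) dscat \<Rightarrow> ('o, 'u, 'u) dmor) \<Rightarrow> bool" where
  "functorial_fibrant_replacement Obs R Rm r \<longleftrightarrow>
     (\<forall>A\<in>sCat Obs. R A \<in> sCat Obs \<and> fibrant (R A) \<and>
        cofibration A (R A) (r A) \<and> local_weak_equivalence A (R A) (r A)) \<and>
     (\<forall>A\<in>sCat Obs. \<forall>B\<in>sCat Obs. \<forall>F. dagger_functor A B F \<longrightarrow>
        dagger_functor (R A) (R B) (Rm A B F) \<and>
        dmor_eq A (dmor_comp (Rm A B F) (r A)) (dmor_comp (r B) F) \<and>
        (\<forall>G. dmor_eq A F G \<longrightarrow> dmor_eq (R A) (Rm A B F) (Rm A B G))) \<and>
     (\<forall>A\<in>sCat Obs. dmor_eq (R A) (Rm A A dmor_id) dmor_id) \<and>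
     (\<forall>A\<in>sCat Obs. \<forall>B\<in>sCat Obs. \<forall>C\<in>sCat Obs. \<forall>F G.
        dagger_functor A B F \<and> dagger_functor B C G \<longrightarrow>
        dmor_eq (R A) (Rm A C (dmor_comp G F)) (dmor_comp (Rm B C G) (Rm A B F)))"


section \<open>Natural dagger intervals\<close>

datatype letter = LA | LAdag

fun src :: "letter \<Rightarrow> nat" where
  "src LA = 0" | "src LAdag = 1"

fun flip :: "letter \<Rightarrow> letter" where
  "flip LA = LAdag" | "flip LAdag = LA"

text \<open>Words are read in the order of traversal: \<open>[LA, LAdag]\<close> stands for the composite of first
  \<open>a\<close> and then its dagger.\<close>

fun walk :: "nat \<Rightarrow> nat \<Rightarrow> letter list \<Rightarrow> bool" where
  "walk x y [] \<longleftrightarrow> x = y"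
| "walk x y (l # w) \<longleftrightarrow> x = src l \<and> walk (src (flip l)) y w"

definition word_dag :: "letter list \<Rightarrow> letter list" where
  "word_dag w = rev (map flip w)"

definition JJ :: "(nat, letter list) dscat" where
  "JJ = discrete_dscat {0, 1} (\<lambda>x y. {w. walk x y w}) (\<lambda>x y z g f. f @ g) (\<lambda>x. [])
          (\<lambda>x y. word_dag)"

text \<open>The quotient of \<^const>\<open>JJ\<close> by the congruence generated by the two unitarity relations.\<close>

definition cancel :: "nat \<Rightarrow> nat \<Rightarrow> letter list \<Rightarrow> letter list \<Rightarrow> bool" where
  "cancel x y w v \<longleftrightarrow> walk x y w \<and> walk x y v \<and>
     (\<exists>p s. (w = p @ [LA, LAdag] @ s \<or> w = p @ [LAdag, LA] @ s) \<and> v = p @ s)"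

definition word_class :: "nat \<Rightarrow> nat \<Rightarrow> letter list \<Rightarrow> letter list set" where
  "word_class x y w = {v. equivclp (cancel x y) w v}"

definition II :: "(nat, letter list set) dscat" where
  "II = discrete_dscat {0, 1} (\<lambda>x y. word_class x y ` {w. walk x y w})
          (\<lambda>x y z G F. \<Union>g\<in>G. \<Union>f\<in>F. word_class x z (f @ g)) (\<lambda>x. word_class x x [])
          (\<lambda>x y F. \<Union>f\<in>F. word_class y x (word_dag f))"

definition qJI :: "(nat, letter list, letter list set) dmor" where
  "qJI = (\<lambda>x y n. word_class x y)"

definition natural_dagger_interval ::
  "(nat, 'u) dscat \<Rightarrow> (nat, letter list, 'u) dmor \<Rightarrow> (nat, 'u, letter list set) dmor \<Rightarrow> bool" where
  "natural_dagger_interval H j p \<longleftrightarrow>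
     dagger_functor JJ H j \<and> dagger_functor H II p \<and> dmor_eq JJ (dmor_comp p j) qJI \<and>
     cofibration JJ H j \<and> local_weak_equivalence H II p \<and>
     (\<forall>x\<in>obj H. \<forall>y\<in>obj H. \<forall>n. countable (mor H x y n))"


section \<open>Weakly and coherently unitary morphisms\<close>

text \<open>Composition, identities and dagger of the homotopy category, whose hom-sets are
  \<open>pi0 (maps C x y)\<close>.\<close>

definition ho_cmp :: "('o, 'a) dscat \<Rightarrow> 'o \<Rightarrow> 'o \<Rightarrow> 'o \<Rightarrow> 'a set \<Rightarrow> 'a set \<Rightarrow> 'a set" where
  "ho_cmp C x y z b a = (\<Union>g\<in>b. \<Union>f\<in>a. pi0_class (maps C x z) (cmp C x y z 0 g f))"

definition ho_id :: "('o, 'a) dscat \<Rightarrow> 'o \<Rightarrow> 'a set" where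
  "ho_id C x = pi0_class (maps C x x) (idm C x)"

definition ho_dag :: "('o, 'a) dscat \<Rightarrow> 'o \<Rightarrow> 'o \<Rightarrow> 'a set \<Rightarrow> 'a set" where
  "ho_dag C x y a = (\<Union>f\<in>a. pi0_class (maps C y x) (dag C x y 0 f))"

definition ho_inverse :: "('o, 'a) dscat \<Rightarrow> 'o \<Rightarrow> 'o \<Rightarrow> 'a set \<Rightarrow> 'a set \<Rightarrow> bool" where
  "ho_inverse C x y a b \<longleftrightarrow> a \<in> pi0 (maps C x y) \<and> b \<in> pi0 (maps C y x) \<and>
     ho_cmp C x y x b a = ho_id C x \<and> ho_cmp C y x y a b = ho_id C y"

definition weakly_unitary :: "('o, 'a) dscat \<Rightarrow> 'o \<Rightarrow> 'o \<Rightarrow> 'a \<Rightarrow> bool" where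
  "weakly_unitary C x y u \<longleftrightarrow> u \<in> mor C x y 0 \<and>
     (\<exists>b. ho_inverse C x y (pi0_class (maps C x y) u) b \<and>
          ho_dag C x y (pi0_class (maps C x y) u) = b)"

definition two_object :: "('o, 'a) dscat \<Rightarrow> 'o \<Rightarrow> 'o \<Rightarrow> (nat, 'a) dscat" where
  "two_object C x y = (let e = (\<lambda>i::nat. if i = 0 then x else y) in
     \<lparr>obj = {0, 1}, maps = (\<lambda>i j. maps C (e i) (e j)),
      cmp = (\<lambda>i j k. cmp C (e i) (e j) (e k)), idm = (\<lambda>i. idm C (e i)),
      dag = (\<lambda>i j. dag C (e i) (e j))\<rparr>)"

definition coherently_unitary ::
  "((nat, 'u) dscat \<Rightarrow> (nat, 'u) dscat) \<Rightarrow> ((nat, 'u) dscat \<Rightarrow> (nat, 'u, 'u) dmor)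
   \<Rightarrow> ('o, 'u) dscat \<Rightarrow> 'o \<Rightarrow> 'o \<Rightarrow> 'u \<Rightarrow> bool" where
  "coherently_unitary R r C x y u \<longleftrightarrow> u \<in> mor C x y 0 \<and>
     (\<exists>(H :: (nat, 'u) dscat) j p \<Phi>. natural_dagger_interval H j p \<and>
        dagger_functor H (R (two_object C x y)) \<Phi> \<and>
        pi0_class (maps (R (two_object C x y)) 0 1) (\<Phi> 0 1 0 (j 0 1 0 [LA]))
          = pi0_class (maps (R (two_object C x y)) 0 1) (r (two_object C x y) 0 1 0 u))"


section \<open>The twisted circle\<close>

definition sing :: "'g topology \<Rightarrow> ((nat \<Rightarrow> real) \<Rightarrow> 'g) sset" where
  "sing T = \<lparr>simplices = (\<lambda>n. singular_simplex_set n T),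
     act = (\<lambda>m n \<alpha> f. restrict (f \<circ> push_coords m \<alpha>) (standard_simplex m))\<rparr>"

definition sing_point :: "'g \<Rightarrow> (nat \<Rightarrow> real) \<Rightarrow> 'g" where
  "sing_point g = (\<lambda>_\<in>standard_simplex 0. g)"

text \<open>The one-object dagger simplicial category of a topological monoid with an anti-involution
  \<open>d\<close>.\<close>

definition sing_dscat ::
  "'g topology \<Rightarrow> ('g \<Rightarrow> 'g \<Rightarrow> 'g) \<Rightarrow> 'g \<Rightarrow> ('g \<Rightarrow> 'g) \<Rightarrow> (unit, (nat \<Rightarrow> real) \<Rightarrow> 'g) dscat" where
  "sing_dscat T mul e d =
     \<lparr>obj = {()}, maps = (\<lambda>_ _. sing T),
      cmp = (\<lambda>_ _ _ n g f. \<lambda>t\<in>standard_simplex n. mul (g t) (f t)),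
      idm = (\<lambda>_. sing_point e),
      dag = (\<lambda>_ _ n f. \<lambda>t\<in>standard_simplex n. d (f t))\<rparr>"

text \<open>Transport along an injection of the simplices into a universe \<open>'u\<close>.\<close>

definition relabel :: "('a \<Rightarrow> 'u) \<Rightarrow> ('o, 'a) dscat \<Rightarrow> ('o, 'u) dscat" where
  "relabel \<iota> C =
     \<lparr>obj = obj C,
      maps = (\<lambda>x y. \<lparr>simplices = (\<lambda>n. \<iota> ` mor C x y n),
                     act = (\<lambda>m n \<alpha> s. \<iota> (act (maps C x y) m n \<alpha> (inv_into UNIV \<iota> s)))\<rparr>),
      cmp = (\<lambda>x y z n g f. \<iota> (cmp C x y z n (inv_into UNIV \<iota> g) (inv_into UNIV \<iota> f))),
      idm = (\<lambda>x. \<iota> (idm C x)),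
      dag = (\<lambda>x y n f. \<iota> (dag C x y n (inv_into UNIV \<iota> f)))\<rparr>"

text \<open>The group of order two is \<open>{1, -1}\<close>, with \<open>omega = -1\<close>.\<close>

definition omega :: int where
  "omega = -1"

definition G_top :: "(complex \<times> int) topology" where
  "G_top = prod_topology (top_of_set (sphere 0 1)) (discrete_topology {1, omega})"

definition G_mul :: "complex \<times> int \<Rightarrow> complex \<times> int \<Rightarrow> complex \<times> int" where
  "G_mul g h = (fst g * fst h, snd g * snd h)"

definition G_one :: "complex \<times> int" where
  "G_one = (1, 1)"

definition G_inv :: "complex \<times> int \<Rightarrow> complex \<times> int" where
  "G_inv g = (inverse (fst g), snd g)"

definition theta :: "complex \<times> int \<Rightarrow> complex \<times> int" where
  "theta g = (if snd g = omega then (- fst g, snd g) else g)"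

definition twisted_circle :: "(unit, (nat \<Rightarrow> real) \<Rightarrow> complex \<times> int) dscat" where
  "twisted_circle = sing_dscat G_top G_mul G_one (\<lambda>g. theta (G_inv g))"


section \<open>Well-definedness of the constructions\<close>

lemma discrete_simplicial_set: "simplicial_set (discrete_sset M)"
  by unfold_locales (auto simp: discrete_sset_def)

lemma DeltaD: "\<alpha> \<in> Delta m n \<Longrightarrow> i \<le> m \<Longrightarrow> \<alpha> i \<le> n"
  by (auto simp: Delta_def PiE_def Pi_def)

lemma compose_Delta: "\<lbrakk>\<alpha> \<in> Delta m n; \<beta> \<in> Delta l m\<rbrakk> \<Longrightarrow> compose {..l} \<alpha> \<beta> \<in> Delta l n"
proof -
  assume a: "\<alpha> \<in> Delta m n" and b: "\<beta> \<in> Delta l m"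
  have "\<alpha> (\<beta> i) \<le> \<alpha> (\<beta> j)" if "i \<le> j" "j \<le> l" for i j
  proof -
    have "\<beta> i \<le> \<beta> j" using b that by (auto simp: Delta_def mono_on_def)
    then show ?thesis using a DeltaD[OF b that(2)] by (auto simp: Delta_def mono_on_def)
  qed
  then show ?thesis
    using DeltaD[OF a] DeltaD[OF b] by (simp add: Delta_def compose_def mono_on_def PiE_def Pi_def)
qed

lemma std_simplicial_set: "simplicial_set (std_sset n)"
proof
  fix \<alpha> m k s assume "\<alpha> \<in> Delta m k" "s \<in> simplices (std_sset n) k"
  then show "act (std_sset n) m k \<alpha> s \<in> simplices (std_sset n) m"
    by (simp add: std_sset_def compose_Delta)
next
  fix s k assume "s \<in> simplices (std_sset n) k"
  then show "act (std_sset n) k k (\<lambda>i\<in>{..k}. i) s = s"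
    by (auto simp: std_sset_def Delta_def compose_def PiE_def extensional_def fun_eq_iff)
next
  fix \<alpha> m k \<beta> l s assume "\<alpha> \<in> Delta m k" "\<beta> \<in> Delta l m" "s \<in> simplices (std_sset n) k"
  then show "act (std_sset n) l k (compose {..l} \<alpha> \<beta>) s = act (std_sset n) l m \<beta> (act (std_sset n) m k \<alpha> s)"
    using DeltaD[OF \<open>\<beta> \<in> Delta l m\<close>] by (simp add: std_sset_def compose_def fun_eq_iff)
qed

lemma horn_simplicial_set: "simplicial_set (horn n k)"
proof -
  interpret S: simplicial_set "std_sset n" by (rule std_simplicial_set)
  have sub: "s \<in> simplices (horn n k) q \<Longrightarrow> s \<in> simplices (std_sset n) q" for s q
    by (simp add: horn_def std_sset_def)
  have a: "act (horn n k) = act (std_sset n)" by (simp add: horn_def)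
  show ?thesis
  proof
    fix \<alpha> m q s assume 1: "\<alpha> \<in> Delta m q" "s \<in> simplices (horn n k) q"
    then obtain i where i: "i \<le> n" "i \<noteq> k" "i \<notin> s ` {..q}" by (auto simp: horn_def)
    have "i \<notin> compose {..m} s \<alpha> ` {..m}"
      using i(3) DeltaD[OF 1(1)] by (auto simp: compose_def)
    moreover have "compose {..m} s \<alpha> \<in> Delta m n"
      using 1 compose_Delta by (auto simp: horn_def)
    ultimately show "act (horn n k) m q \<alpha> s \<in> simplices (horn n k) m"
      using i by (auto simp: horn_def std_sset_def)
  next
    fix s q assume "s \<in> simplices (horn n k) q"
    then show "act (horn n k) q q (\<lambda>i\<in>{..q}. i) s = s" unfolding a by (intro S.act_id sub)
  next
    fix \<alpha> m q \<beta> l s assume "\<alpha> \<in> Delta m q" "\<beta> \<in> Delta l m" "s \<in> simplices (horn n k) q"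
    then show "act (horn n k) l q (compose {..l} \<alpha> \<beta>) s
        = act (horn n k) l m \<beta> (act (horn n k) m q \<alpha> s)"
      unfolding a by (intro S.act_compose sub)
  qed
qed

lemma push_coords_in:
  assumes "\<alpha> \<in> Delta m n" "t \<in> standard_simplex m"
  shows "push_coords m \<alpha> t \<in> standard_simplex n"
proof -
  have t: "0 \<le> t i" for i using assms(2) by (auto simp: standard_simplex_def)
  have s1: "(\<Sum>i\<le>m. t i) = 1" using assms(2) by (auto simp: standard_simplex_def)
  have le: "push_coords m \<alpha> t j \<le> 1" for j
    unfolding push_coords_def s1[symmetric] by (rule sum_mono2) (auto simp: t)
  have z: "push_coords m \<alpha> t j = 0" if "j > n" for j
  proof -
    have "{i. i \<le> m \<and> \<alpha> i = j} = {}" using that by (auto dest!: DeltaD[OF assms(1)])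
    then show ?thesis unfolding push_coords_def by (metis sum.empty)
  qed
  have "(\<Sum>j\<le>n. push_coords m \<alpha> t j) = (\<Sum>j\<in>{..n}. \<Sum>i\<in>{i\<in>{..m}. \<alpha> i = j}. t i)"
    by (simp add: push_coords_def)
  also have "\<dots> = (\<Sum>i\<le>m. t i)"
    by (rule sum.group) (use DeltaD[OF assms(1)] in auto)
  finally have "(\<Sum>j\<le>n. push_coords m \<alpha> t j) = 1" using s1 by simp
  moreover have "0 \<le> push_coords m \<alpha> t j" for j unfolding push_coords_def by (simp add: t sum_nonneg)
  ultimately show ?thesis using le z by (auto simp: standard_simplex_def)
qed

lemma push_coords_id:
  assumes "t \<in> standard_simplex n"
  shows "push_coords n (\<lambda>i\<in>{..n}. i) t = t"
proof
  fix j
  have "{i. i \<le> n \<and> (\<lambda>i\<in>{..n}. i) i = j} = (if j \<le> n then {j} else {})" by auto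
  then have "push_coords n (\<lambda>i\<in>{..n}. i) t j = (if j \<le> n then t j else 0)"
    unfolding push_coords_def by (metis sum.empty sum.insert finite.emptyI empty_iff add.right_neutral)
  then show "push_coords n (\<lambda>i\<in>{..n}. i) t j = t j" 
    using assms by (auto simp: standard_simplex_def)
qed

lemma push_coords_compose:
  assumes "\<alpha> \<in> Delta m n" "\<beta> \<in> Delta l m"
  shows "push_coords l (compose {..l} \<alpha> \<beta>) t = push_coords m \<alpha> (push_coords l \<beta> t)"
proof
  fix j
  have "push_coords m \<alpha> (push_coords l \<beta> t) j
      = (\<Sum>i\<in>{i. i \<le> m \<and> \<alpha> i = j}. \<Sum>k\<in>{k\<in>{k. k \<le> l \<and> \<alpha> (\<beta> k) = j}. \<beta> k = i}. t k)"
    unfolding push_coords_def by (intro sum.cong refl) auto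
  also have "\<dots> = (\<Sum>k | k \<le> l \<and> \<alpha> (\<beta> k) = j. t k)"
    by (rule sum.group) (use DeltaD[OF assms(2)] in auto)
  also have "\<dots> = push_coords l (compose {..l} \<alpha> \<beta>) t j"
    unfolding push_coords_def by (intro sum.cong) (auto simp: compose_def)
  finally show "push_coords l (compose {..l} \<alpha> \<beta>) t j = push_coords m \<alpha> (push_coords l \<beta> t) j" by simp
qed

lemma continuous_push_coords:
  assumes "\<alpha> \<in> Delta m n"
  shows "continuous_map (simplex_top m) (simplex_top n) (push_coords m \<alpha>)"
proof -
  have "continuous_map (simplex_top m) euclideanreal (\<lambda>t. push_coords m \<alpha> t j)" for j
    unfolding push_coords_def simplex_top_def
    by (intro continuous_map_sum continuous_map_from_subtopology continuous_map_product_projection) auto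
  then have "continuous_map (simplex_top m) (powertop_real UNIV) (push_coords m \<alpha>)"
    by (simp add: continuous_map_componentwise_UNIV)
  then show ?thesis
    using push_coords_in[OF assms]
    by (auto simp: simplex_top_def continuous_map_in_subtopology topspace_standard_simplex)
qed

lemma sing_simplicial_set: "simplicial_set (sing T)"
proof
  fix \<alpha> m n s assume "\<alpha> \<in> Delta m n" "s \<in> simplices (sing T) n"
  then have "continuous_map (simplex_top m) T (s \<circ> push_coords m \<alpha>)"
    by (intro continuous_map_compose[OF continuous_push_coords])
       (auto simp: sing_def singular_simplex_def simplex_top_def)
  then have "continuous_map (simplex_top m) T (restrict (s \<circ> push_coords m \<alpha>) (standard_simplex m))"
    by (rule continuous_map_eq) (simp add: simplex_top_def topspace_standard_simplex)
  then show "act (sing T) m n \<alpha> s \<in> simplices (sing T) m"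
    by (simp add: sing_def singular_simplex_def simplex_top_def)
next
  fix s n assume "s \<in> simplices (sing T) n"
  then show "act (sing T) n n (\<lambda>i\<in>{..n}. i) s = s"
    by (auto simp: sing_def singular_simplex_def extensional_def fun_eq_iff push_coords_id restrict_apply)
next
  fix \<alpha> m n \<beta> l s assume "\<alpha> \<in> Delta m n" "\<beta> \<in> Delta l m" "s \<in> simplices (sing T) n"
  then show "act (sing T) l n (compose {..l} \<alpha> \<beta>) s = act (sing T) l m \<beta> (act (sing T) m n \<alpha> s)"
    by (auto simp: sing_def fun_eq_iff push_coords_compose push_coords_in)
qed

lemma sing_dscat_dagger_scat:
  assumes mul: "continuous_map (prod_topology T T) T (\<lambda>(g, h). mul g h)"
    and e: "e \<in> topspace T" and d: "continuous_map T T d"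
    and assoc: "\<And>a b c. \<lbrakk>a \<in> topspace T; b \<in> topspace T; c \<in> topspace T\<rbrakk>
      \<Longrightarrow> mul a (mul b c) = mul (mul a b) c"
    and unit: "\<And>a. a \<in> topspace T \<Longrightarrow> mul e a = a" "\<And>a. a \<in> topspace T \<Longrightarrow> mul a e = a"
    and dd: "\<And>a. a \<in> topspace T \<Longrightarrow> d (d a) = a" and de: "d e = e"
    and dmul: "\<And>a b. \<lbrakk>a \<in> topspace T; b \<in> topspace T\<rbrakk> \<Longrightarrow> d (mul a b) = mul (d b) (d a)"
  shows "dagger_scat (sing_dscat T mul e d)"
proof -
  interpret S: simplicial_set "sing T" by (rule sing_simplicial_set)
  let ?C = "sing_dscat T mul e d"
  have in_T: "f t \<in> topspace T" if "f \<in> simplices (sing T) n" "t \<in> standard_simplex n" for f n t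
    using that unfolding sing_def singular_simplex_def
    by (auto dest!: continuous_map_image_subset_topspace simp: topspace_standard_simplex)
  have memI: "(\<lambda>t\<in>standard_simplex n. f t) \<in> simplices (sing T) n"
    if "continuous_map (simplex_top n) T f" for f n
  proof -
    have "continuous_map (simplex_top n) T (\<lambda>t\<in>standard_simplex n. f t)"
      using that by (rule continuous_map_eq) (simp add: simplex_top_def topspace_standard_simplex)
    then show ?thesis by (simp add: sing_def singular_simplex_def simplex_top_def)
  qed
  have cont: "continuous_map (simplex_top n) T f" if "f \<in> simplices (sing T) n" for f n
    using that by (simp add: sing_def singular_simplex_def simplex_top_def)
  have mulcl: "(\<lambda>t\<in>standard_simplex n. mul (g t) (f t)) \<in> simplices (sing T) n"
    if "g \<in> simplices (sing T) n" "f \<in> simplices (sing T) n" for g f n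
  proof (rule memI)
    have "continuous_map (simplex_top n) (prod_topology T T) (\<lambda>t. (g t, f t))"
      using that cont by (intro continuous_map_pairedI) 
    from continuous_map_compose[OF this mul]
    show "continuous_map (simplex_top n) T (\<lambda>t. mul (g t) (f t))" by (simp add: o_def)
  qed
  have dcl: "(\<lambda>t\<in>standard_simplex n. d (f t)) \<in> simplices (sing T) n"
    if "f \<in> simplices (sing T) n" for f n
    using memI[OF continuous_map_compose[OF cont[OF that] d]] by (simp add: o_def)
  have ptcl: "sing_point e \<in> simplices (sing T) 0"
    unfolding sing_point_def by (rule memI) (simp add: e)
  have c0: "const_op n 0 \<in> Delta n 0" for n
    by (auto simp: const_op_def Delta_def mono_on_def)
  have idn: "idn ?C x n = (\<lambda>t\<in>standard_simplex n. e)" for x n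
    using push_coords_in[OF c0]
    by (auto simp: idn_def sing_dscat_def sing_def sing_point_def fun_eq_iff)
  note sd = sing_dscat_def
  show ?thesis
  proof (rule dagger_scat.intro)
    fix x y assume "x \<in> obj ?C" "y \<in> obj ?C"
    show "simplicial_set (maps ?C x y)" by (simp add: sd S.simplicial_set_axioms)
    show "smap (maps ?C x y) (maps ?C y x) (dag ?C x y)"
      unfolding smap_def
      using dcl push_coords_in by (auto simp: sd) (auto simp: sing_def fun_eq_iff)
  next
    fix x y z n g f assume *: "g \<in> mor ?C y z n" "f \<in> mor ?C x y n"
    then show "cmp ?C x y z n g f \<in> mor ?C x z n" by (simp add: sd mulcl)
    show "dag ?C x z n (cmp ?C x y z n g f) = cmp ?C z y x n (dag ?C x y n f) (dag ?C y z n g)"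
      using * in_T by (auto simp: sd dmul fun_eq_iff)
    fix \<alpha> m assume "\<alpha> \<in> Delta m n"
    then show "act (maps ?C x z) m n \<alpha> (cmp ?C x y z n g f)
          = cmp ?C x y z m (act (maps ?C y z) m n \<alpha> g) (act (maps ?C x y) m n \<alpha> f)"
      using push_coords_in by (auto simp: sd sing_def fun_eq_iff)
  next
    fix w x y z h g f n assume "h \<in> mor ?C y z n" "g \<in> mor ?C x y n" "f \<in> mor ?C w x n"
    then show "cmp ?C w y z n h (cmp ?C w x y n g f) = cmp ?C w x z n (cmp ?C x y z n h g) f"
      using in_T by (auto simp: sd assoc fun_eq_iff)
  next
    fix x show "idm ?C x \<in> mor ?C x x 0" by (simp add: sd ptcl)
    show "dag ?C x x 0 (idm ?C x) = idm ?C x" by (auto simp: sd sing_point_def de fun_eq_iff)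
  next
    fix x y f n assume *: "f \<in> mor ?C x y n"
    then have f: "f \<in> simplices (sing T) n" by (simp add: sd)
    then have ext: "f t = undefined" if "t \<notin> standard_simplex n" for t
      using that by (simp add: sing_def singular_simplex_def extensional_def)
    show "cmp ?C x y y n (idn ?C y n) f = f" "cmp ?C x x y n f (idn ?C x n) = f"
         "dag ?C y x n (dag ?C x y n f) = f"
      using in_T[OF f] ext by (auto simp: idn) (auto simp: sd unit dd fun_eq_iff)
  qed
qed

lemma continuous_map_times_complex:
  assumes "continuous_map X euclidean f" "continuous_map X euclidean g"
  shows "continuous_map X euclidean (\<lambda>x. f x * g x :: complex)"
proof -
  have "continuous_map X euclidean (\<lambda>x. (f x, g x))"
    using continuous_map_pairedI[OF assms] by simp
  moreover have "continuous_map euclidean euclidean (\<lambda>p. fst p * snd p :: complex)"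
    by (simp add: continuous_on_mult continuous_on_fst continuous_on_snd)
  ultimately have "continuous_map X euclidean ((\<lambda>p. fst p * snd p) \<circ> (\<lambda>x. (f x, g x)))"
    by (rule continuous_map_compose)
  then show ?thesis by (simp add: o_def)
qed

lemma twisted_circle_dagger_scat: "dagger_scat twisted_circle"
  unfolding twisted_circle_def
proof (rule sing_dscat_dagger_scat)
  have ts: "topspace G_top = sphere 0 1 \<times> {1, omega}" by (simp add: G_top_def)
  note d = G_mul_def G_one_def G_inv_def theta_def omega_def
  let ?S = "top_of_set (sphere (0::complex) 1)" and ?D = "discrete_topology {1, omega}"
  have disc: "prod_topology ?D ?D = discrete_topology ({1,omega} \<times> {1,omega})"
    by (metis prod_topology_discrete_topology)
  have f: "continuous_map G_top euclidean fst"
    unfolding G_top_def using continuous_map_fst continuous_map_in_subtopology by blast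
  have s: "continuous_map G_top ?D snd" unfolding G_top_def by (rule continuous_map_snd)
  have p1: "continuous_map (prod_topology G_top G_top) G_top fst"
    and p2: "continuous_map (prod_topology G_top G_top) G_top snd"
    by (rule continuous_map_fst continuous_map_snd)+
  have "continuous_map (prod_topology G_top G_top) euclidean (\<lambda>p. fst (fst p) * fst (snd p))"
    using continuous_map_compose[OF p1 f] continuous_map_compose[OF p2 f]
    by (intro continuous_map_times_complex) (simp_all add: o_def)
  then have c1: "continuous_map (prod_topology G_top G_top) ?S (\<lambda>p. fst (fst p) * fst (snd p))"
    by (auto simp: continuous_map_in_subtopology ts norm_mult)
  have "continuous_map (discrete_topology ({1,omega} \<times> {1,omega})) ?D (\<lambda>p. fst p * snd p)"
    by (auto simp: omega_def)
  then have d1: "continuous_map (prod_topology ?D ?D) ?D (\<lambda>p. fst p * snd p)" unfolding disc .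
  have d2: "continuous_map (prod_topology G_top G_top) (prod_topology ?D ?D) (\<lambda>p. (snd (fst p), snd (snd p)))"
    using continuous_map_compose[OF p1 s] continuous_map_compose[OF p2 s]
    by (intro continuous_map_pairedI) (simp_all add: o_def)
  have c2: "continuous_map (prod_topology G_top G_top) ?D (\<lambda>p. snd (fst p) * snd (snd p))"
    using continuous_map_compose[OF d2 d1] by (simp add: o_def)
  show "continuous_map (prod_topology G_top G_top) G_top (\<lambda>(g, h). G_mul g h)"
    using continuous_map_pairedI[OF c1 c2]
    unfolding G_mul_def case_prod_beta G_top_def[symmetric] .
  let ?e = "\<lambda>w. if w = omega then - 1 else 1 :: complex"
  have "continuous_map G_top euclidean (\<lambda>g. ?e (snd g))"
    using continuous_map_compose[OF s, of euclidean ?e] by (auto simp: o_def)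
  moreover have "continuous_map G_top euclidean (\<lambda>g. inverse (fst g))"
  proof -
    have "continuous_map G_top ?S fst" unfolding G_top_def by (rule continuous_map_fst)
    moreover have "continuous_map ?S euclidean inverse"
      by (auto intro!: continuous_intros)
    ultimately have "continuous_map G_top euclidean (inverse \<circ> fst)"
      by (rule continuous_map_compose)
    then show ?thesis by (simp add: o_def)
  qed
  ultimately have "continuous_map G_top euclidean (\<lambda>g. ?e (snd g) * inverse (fst g))"
    by (intro continuous_map_times_complex)
  then have c3: "continuous_map G_top ?S (\<lambda>g. ?e (snd g) * inverse (fst g))"
    by (auto simp: continuous_map_in_subtopology ts norm_mult norm_inverse)
  have eq: "theta (G_inv g) = (?e (snd g) * inverse (fst g), snd g)" for g
    by (auto simp: d)
  show "continuous_map G_top G_top (\<lambda>g. theta (G_inv g))"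
    using continuous_map_pairedI[OF c3 s] by (simp add: eq G_top_def[symmetric])
qed (auto simp: G_top_def G_mul_def G_one_def G_inv_def theta_def omega_def)

lemma relabel_dagger_scat:
  assumes "inj \<iota>" "dagger_scat C" shows "dagger_scat (relabel \<iota> C)"
proof -
  interpret C: dagger_scat C by fact
  have inv: "inv_into UNIV \<iota> (\<iota> s) = s" for s using assms(1) by simp
  have idn: "idn (relabel \<iota> C) x n = \<iota> (idn C x n)" for x n by (simp add: idn_def relabel_def inv)
  show ?thesis
  proof (rule dagger_scat.intro)
    fix x y assume "x \<in> obj (relabel \<iota> C)" "y \<in> obj (relabel \<iota> C)"
    then have xy: "x \<in> obj C" "y \<in> obj C" by (simp_all add: relabel_def)
    interpret X: simplicial_set "maps C x y" using xy by (rule C.maps_sset)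
    show "simplicial_set (maps (relabel \<iota> C) x y)"
      by unfold_locales (auto simp: relabel_def inv X.act_closed X.act_id X.act_compose)
    show "smap (maps (relabel \<iota> C) x y) (maps (relabel \<iota> C) y x) (dag (relabel \<iota> C) x y)"
      using C.dag_smap[OF xy] by (auto simp: smap_def relabel_def inv)
  qed (unfold idn, auto simp: relabel_def inv C.cmp_closed C.cmp_act C.cmp_assoc C.idm_closed C.cmp_id_left
        C.cmp_id_right C.dag_dag C.dag_idm C.dag_cmp)
qed

lemma two_object_dagger_scat:
  assumes "dagger_scat C" "x \<in> obj C" "y \<in> obj C" shows "two_object C x y \<in> sCat {0, 1}"
proof -
  interpret C: dagger_scat C by fact
  define e where "e = (\<lambda>i::nat. if i = 0 then x else y)"
  have e: "e i \<in> obj C" for i using assms by (simp add: e_def)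
  have T: "two_object C x y = \<lparr>obj = {0, 1}, maps = (\<lambda>i j. maps C (e i) (e j)),
      cmp = (\<lambda>i j k. cmp C (e i) (e j) (e k)), idm = (\<lambda>i. idm C (e i)),
      dag = (\<lambda>i j. dag C (e i) (e j))\<rparr>" by (simp add: two_object_def e_def)
  have idn: "idn (two_object C x y) i n = idn C (e i) n" for i n by (simp add: idn_def T)
  have "dagger_scat (two_object C x y)"
    by (rule dagger_scat.intro) (unfold idn, auto simp: T C.maps_sset C.cmp_closed C.cmp_act C.cmp_assoc C.idm_closed
        C.cmp_id_left C.cmp_id_right C.dag_smap C.dag_dag C.dag_idm C.dag_cmp e)
  then show ?thesis by (simp add: sCat_def T)
qed

lemma discrete_dagger_scat:
  assumes "\<And>x y z g f. \<lbrakk>x \<in> O'; y \<in> O'; z \<in> O'; g \<in> M y z; f \<in> M x y\<rbrakk> \<Longrightarrow> c x y z g f \<in> M x z"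
    and "\<And>w x y z h g f. \<lbrakk>w \<in> O'; x \<in> O'; y \<in> O'; z \<in> O'; h \<in> M y z; g \<in> M x y; f \<in> M w x\<rbrakk>
      \<Longrightarrow> c w y z h (c w x y g f) = c w x z (c x y z h g) f"
    and "\<And>x. x \<in> O' \<Longrightarrow> i x \<in> M x x"
    and "\<And>x y f. \<lbrakk>x \<in> O'; y \<in> O'; f \<in> M x y\<rbrakk> \<Longrightarrow> c x y y (i y) f = f"
    and "\<And>x y f. \<lbrakk>x \<in> O'; y \<in> O'; f \<in> M x y\<rbrakk> \<Longrightarrow> c x x y f (i x) = f"
    and "\<And>x y f. \<lbrakk>x \<in> O'; y \<in> O'; f \<in> M x y\<rbrakk> \<Longrightarrow> d x y f \<in> M y x"
    and "\<And>x y f. \<lbrakk>x \<in> O'; y \<in> O'; f \<in> M x y\<rbrakk> \<Longrightarrow> d y x (d x y f) = f"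
    and "\<And>x. x \<in> O' \<Longrightarrow> d x x (i x) = i x"
    and "\<And>x y z g f. \<lbrakk>x \<in> O'; y \<in> O'; z \<in> O'; g \<in> M y z; f \<in> M x y\<rbrakk>
      \<Longrightarrow> d x z (c x y z g f) = c z y x (d x y f) (d y z g)"
  shows "dagger_scat (discrete_dscat O' M c i d)"
  by (rule dagger_scat.intro)
     (use discrete_simplicial_set in \<open>auto simp: discrete_dscat_def idn_def smap_def assms\<close>,
      auto simp: discrete_sset_def assms)

lemma walk_append: "walk x y w \<Longrightarrow> walk y z v \<Longrightarrow> walk x z (w @ v)"
  by (induction w arbitrary: x) auto

lemma walk_append_iff: "walk x z (w @ v) \<longleftrightarrow> (\<exists>y. walk x y w \<and> walk y z v)"
  by (induction w arbitrary: x) auto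

lemma flip_flip [simp]: "flip (flip l) = l" by (cases l) auto

lemma walk_dag: "walk x y w \<Longrightarrow> walk y x (word_dag w)"
proof (induction w arbitrary: x)
  case (Cons l w)
  then have "walk y (src (flip l)) (word_dag w)" "walk (src (flip l)) x [flip l]" by auto
  then show ?case by (simp add: word_dag_def walk_append)
qed (simp add: word_dag_def)

lemma word_dag_simps: "word_dag (word_dag w) = w" "word_dag (v @ w) = word_dag w @ word_dag v"
  "word_dag [] = []"
  by (simp_all add: word_dag_def rev_map o_def)

lemma JJ_dagger_scat: "dagger_scat JJ"
  unfolding JJ_def by (rule discrete_dagger_scat) (auto simp: walk_append walk_dag word_dag_simps)

lemma walk_cancel_equiv: 
  assumes "equivclp (cancel x y) w v" "walk x y w" shows "walk x y v"
  using assms by (induction rule: equivclp_induct) (auto simp: cancel_def)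

lemma equivclp_map:
  assumes "equivclp P a b" "\<And>a b. P a b \<Longrightarrow> equivclp Q (f a) (f b)"
  shows "equivclp Q (f a) (f b)"
  using assms(1)
  by (induction rule: equivclp_induct) (auto intro: equivclp_trans assms(2) equivclp_sym[OF assms(2)])

lemma cancel_app: 
  assumes "cancel x y w v" "walk u x a" "walk y z b" shows "cancel u z (a @ w @ b) (a @ v @ b)"
proof -
  from assms(1) obtain p s where "w = p @ [LA, LAdag] @ s \<or> w = p @ [LAdag, LA] @ s" "v = p @ s"
    by (auto simp: cancel_def)
  then have "(a @ w @ b = (a @ p) @ [LA, LAdag] @ (s @ b) \<or> a @ w @ b = (a @ p) @ [LAdag, LA] @ (s @ b))
      \<and> a @ v @ b = (a @ p) @ (s @ b)" by auto
  moreover have "walk u z (a @ w @ b)" "walk u z (a @ v @ b)"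
    using assms by (meson cancel_def walk_append)+
  ultimately show ?thesis unfolding cancel_def by blast
qed

lemma cancel_app_equiv:
  assumes "equivclp (cancel x y) f f'" "equivclp (cancel y z) g g'" "walk x y f" "walk y z g"
  shows "equivclp (cancel x z) (f @ g) (f' @ g')"
proof -
  have "equivclp (cancel x z) (f @ g) (f' @ g)"
    using equivclp_map[OF assms(1), of _ "\<lambda>f. f @ g"] cancel_app[of x y _ _ x "[]" z g] assms(4)
    by (simp add: r_into_equivclp)
  moreover have "equivclp (cancel x z) (f' @ g) (f' @ g')"
    using equivclp_map[OF assms(2), of _ "\<lambda>g. f' @ g"] cancel_app[of y z _ _ x f' z "[]"]
      walk_cancel_equiv[OF assms(1,3)]
    by (simp add: r_into_equivclp)
  ultimately show ?thesis by (rule equivclp_trans)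
qed

lemma cancel_dag: "cancel x y w v \<Longrightarrow> cancel y x (word_dag w) (word_dag v)"
proof -
  assume a: "cancel x y w v"
  then obtain p s where "w = p @ [LA, LAdag] @ s \<or> w = p @ [LAdag, LA] @ s" "v = p @ s"
    by (auto simp: cancel_def)
  then have "(word_dag w = word_dag s @ [LA, LAdag] @ word_dag p
        \<or> word_dag w = word_dag s @ [LAdag, LA] @ word_dag p) \<and> word_dag v = word_dag s @ word_dag p"
    by (auto simp: word_dag_def)
  then show ?thesis using a walk_dag unfolding cancel_def by blast
qed

lemma word_class_eqI: "equivclp (cancel x y) w v \<Longrightarrow> word_class x y w = word_class x y v"
  unfolding word_class_def by (auto intro: equivclp_trans equivclp_sym)

lemma II_cmp:
  assumes "walk x y f" "walk y z g"
  shows "(\<Union>g\<in>word_class y z g. \<Union>f\<in>word_class x y f. word_class x z (f @ g)) = word_class x z (f @ g)"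
proof -
  have "word_class x z (f' @ g') = word_class x z (f @ g)"
    if "g' \<in> word_class y z g" "f' \<in> word_class x y f" for f' g'
    by (rule word_class_eqI[symmetric]) 
       (use that cancel_app_equiv[of x y f f' z g g'] assms in \<open>simp add: word_class_def\<close>)
  moreover have "g \<in> word_class y z g" "f \<in> word_class x y f" by (auto simp: word_class_def)
  ultimately show ?thesis by blast
qed

lemma II_dag:
  assumes "walk x y f"
  shows "(\<Union>f\<in>word_class x y f. word_class y x (word_dag f)) = word_class y x (word_dag f)"
proof -
  have "word_class y x (word_dag f') = word_class y x (word_dag f)" if "f' \<in> word_class x y f" for f'
    by (rule word_class_eqI[symmetric], rule equivclp_map[where P = "cancel x y"])
       (use that cancel_dag in \<open>auto simp: word_class_def\<close>)
  moreover have "f \<in> word_class x y f" by (auto simp: word_class_def)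
  ultimately show ?thesis by blast
qed

lemma II_dagger_scat: "dagger_scat II"
proof -
  let ?O = "{0, 1 :: nat}"
  let ?M = "\<lambda>x y. word_class x y ` {w. walk x y w}"
  have M: "\<exists>f. F = word_class x y f \<and> walk x y f" if "F \<in> ?M x y" for F x y
    using that by blast
  have MI: "word_class x y f \<in> ?M x y" if "walk x y f" for x y f using that by blast
  have nil: "walk x x []" for x by simp
  show ?thesis
    unfolding II_def
  proof (rule discrete_dagger_scat)
    fix x y z G F assume "G \<in> ?M y z" "F \<in> ?M x y"
    then obtain g f where [simp]: "G = word_class y z g" "F = word_class x y f"
      and w: "walk y z g" "walk x y f" using M by meson
    note d = II_cmp[OF w(2,1)] II_dag[OF w(1)] II_dag[OF w(2)] II_dag[OF walk_append[OF w(2,1)]]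
      II_cmp[OF walk_dag[OF w(1)] walk_dag[OF w(2)]]
    show "(\<Union>g\<in>G. \<Union>f\<in>F. word_class x z (f @ g)) \<in> ?M x z"
      unfolding \<open>G = _\<close> \<open>F = _\<close> d by (rule MI, rule walk_append[OF w(2,1)])
    show "(\<Union>f\<in>\<Union>g\<in>G. \<Union>f\<in>F. word_class x z (f @ g). word_class z x (word_dag f))
        = (\<Union>g\<in>\<Union>f\<in>F. word_class y x (word_dag f). \<Union>f\<in>\<Union>f\<in>G. word_class z y (word_dag f).
             word_class z x (f @ g))"
      unfolding \<open>G = _\<close> \<open>F = _\<close> d word_dag_simps ..
  next
    fix w x y z H G F assume "H \<in> ?M y z" "G \<in> ?M x y" "F \<in> ?M w x"
    then obtain h g f where e: "H = word_class y z h" "G = word_class x y g" "F = word_class w x f"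
      and k: "walk y z h" "walk x y g" "walk w x f" using M by meson
    show "(\<Union>g\<in>H. \<Union>f\<in>\<Union>g\<in>G. \<Union>f\<in>F. word_class w y (f @ g). word_class w z (f @ g))
        = (\<Union>g\<in>\<Union>g\<in>H. \<Union>f\<in>G. word_class x z (f @ g). \<Union>f\<in>F. word_class w z (f @ g))"
      unfolding e II_cmp[OF k(2,1)] II_cmp[OF k(3,2)] II_cmp[OF walk_append[OF k(3,2)] k(1)]
        II_cmp[OF k(3) walk_append[OF k(2,1)]] by simp
  next
    fix x show "word_class x x [] \<in> ?M x x" by (rule MI[OF nil])
    show "(\<Union>f\<in>word_class x x []. word_class x x (word_dag f)) = word_class x x []"
      unfolding II_dag[OF nil] word_dag_simps ..
  next
    fix x y F assume "F \<in> ?M x y"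
    then obtain f where e: "F = word_class x y f" and k: "walk x y f" using M by meson
    show "(\<Union>g\<in>word_class y y []. \<Union>f\<in>F. word_class x y (f @ g)) = F"
      unfolding e II_cmp[OF k nil] by simp
    show "(\<Union>g\<in>F. \<Union>f\<in>word_class x x []. word_class x y (f @ g)) = F"
      unfolding e II_cmp[OF nil k] by simp
    show "(\<Union>f\<in>F. word_class y x (word_dag f)) \<in> ?M y x"
      unfolding e II_dag[OF k] by (rule MI[OF walk_dag[OF k]])
    show "(\<Union>f\<in>\<Union>f\<in>F. word_class y x (word_dag f). word_class x y (word_dag f)) = F"
      unfolding e II_dag[OF k] II_dag[OF walk_dag[OF k]] word_dag_simps ..
  qed
qed

lemma qJI_dagger_functor: "dagger_functor JJ II qJI"
proof (rule dagger_functor.intro[OF JJ_dagger_scat II_dagger_scat], rule dagger_functor_axioms.intro)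
  show "obj JJ = obj II" by (simp add: JJ_def II_def discrete_dscat_def)
next
  fix x y show "smap (maps JJ x y) (maps II x y) (qJI x y)"
    by (simp add: JJ_def II_def qJI_def discrete_dscat_def discrete_sset_def smap_def)
next
  fix x y z g n f assume "g \<in> mor JJ y z n" "f \<in> mor JJ x y n"
  then show "qJI x z n (cmp JJ x y z n g f) = cmp II x y z n (qJI y z n g) (qJI x y n f)"
    using II_cmp[of x y f z g] by (simp add: JJ_def II_def qJI_def discrete_dscat_def discrete_sset_def)
next
  fix x show "qJI x x 0 (idm JJ x) = idm II x"
    by (simp add: JJ_def II_def qJI_def discrete_dscat_def)
next
  fix x y f n assume "f \<in> mor JJ x y n"
  then show "qJI y x n (dag JJ x y n f) = dag II x y n (qJI x y n f)"
    using II_dag[of x y f] by (simp add: JJ_def II_def qJI_def discrete_dscat_def discrete_sset_def)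
qed

lemma terminal_dscat_dagger_scat: "dagger_scat (terminal_dscat Obs)"
  unfolding terminal_dscat_def by (rule discrete_dagger_scat) auto

lemma istopology_realization:
  "istopology (\<lambda>U. U \<subseteq> real_pt X ` topspace (cells_top X) \<and>
     openin (cells_top X) {p \<in> topspace (cells_top X). real_pt X p \<in> U})"
proof -
  have 1: "{p \<in> topspace (cells_top X). real_pt X p \<in> S \<inter> T}
    = {p \<in> topspace (cells_top X). real_pt X p \<in> S} \<inter> {p \<in> topspace (cells_top X). real_pt X p \<in> T}"
    for S T by auto
  have 2: "{p \<in> topspace (cells_top X). real_pt X p \<in> \<Union>\<K>}
    = \<Union>((\<lambda>U. {p \<in> topspace (cells_top X). real_pt X p \<in> U}) ` \<K>)" for \<K> by auto
  show ?thesis unfolding istopology_def 1 2 by (auto intro!: openin_Union)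
qed

end

theory Submission
  imports Defs "HOL-Complex_Analysis.Winding_Numbers"
begin

text \<open>The element \<open>u = (1, \<omega>)\<close> has \<open>u\<^sup>\<dagger> u = u u\<^sup>\<dagger> = (-1, 1)\<close>. This lies in the identity
  component \<open>S\<^sup>1\<close> of the group, so \<open>u\<close> is weakly unitary (\<open>twisted_circle_semicircle\<close>).

  On the identity component the dagger is \<open>z \<mapsto> z\<inverse>\<close>, that is, complex conjugation. A path from \<open>1\<close> to
  \<open>-1\<close> in \<open>S\<^sup>1\<close> has half-integral winding number, which conjugation negates, so no such path is
  homotopic to its own dagger relative to the end points (\<open>no_self_adjoint_path_G_top\<close>). Coherence
  would produce one. Indeed, the endomorphism space of the object \<open>0\<close> in a natural dagger interval is
  weakly contractible and contains both the identity and \<open>h\<^sup>\<dagger> h\<close>; a path between the two is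
  homotopic to its dagger by simple connectedness. A functor \<open>\<Phi>\<close> carries it to a path from the
  identity to \<open>\<Phi>(h)\<^sup>\<dagger> \<Phi>(h)\<close> in the fibrant replacement, and if \<open>\<Phi>(h)\<close> and \<open>r(u)\<close> are in the
  same component, then \<open>\<Phi>(h)\<^sup>\<dagger> \<Phi>(h)\<close> is joined to \<open>r(u)\<^sup>\<dagger> r(u)\<close> by a path of
  self-adjoint elements (\<open>coherent_self_adjoint_path\<close>). The resulting path is homotopic to its dagger
  and runs from \<open>r(1)\<close> to \<open>r(u\<^sup>\<dagger> u)\<close>. The weak equivalence \<open>r\<close> reflects such paths
  (\<open>lift_self_adjoint_path\<close>), and evaluation \<open>|Sing G| \<rightarrow> G\<close> turns the lifted path into a path in the
  group.

  All paths are topological paths in geometric realizations. Since these are abstract topologies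
  on types without a topological structure of their own, the part of the theory of the fundamental
  groupoid that is needed is developed for abstract topologies. Weak equivalences
  enter by being fully faithful on fundamental groupoids (\<open>weak_equivalence_top_faithful\<close>,
  \<open>weak_equivalence_top_full\<close>).\<close>


section \<open>Paths up to homotopy in an abstract topology\<close>

text \<open>The end points are explicit and the interval is a bare topology, so that a reflexive instance says
  that \<open>p\<close> is a path from \<open>a\<close> to \<open>b\<close>, and points may be of any type, in particular the sets
  of cells that make up a realization.\<close>

definition path_homotopic ::
  "'a topology \<Rightarrow> 'a \<Rightarrow> 'a \<Rightarrow> (real \<Rightarrow> 'a) \<Rightarrow> (real \<Rightarrow> 'a) \<Rightarrow> bool" where
  "path_homotopic X a b p q \<longleftrightarrow>
     homotopic_with (\<lambda>h. h 0 = a \<and> h 1 = b) (top_of_set {0..1}) X p q"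

definition path_join :: "(real \<Rightarrow> 'a) \<Rightarrow> (real \<Rightarrow> 'a) \<Rightarrow> real \<Rightarrow> 'a" where
  "path_join p q = (\<lambda>x. if x \<le> 1/2 then p (2 * x) else q (2 * x - 1))"

definition path_rev :: "(real \<Rightarrow> 'a) \<Rightarrow> real \<Rightarrow> 'a" where
  "path_rev p = (\<lambda>x. p (1 - x))"

lemma path_homotopic_refl_iff: "path_homotopic X a b p p \<longleftrightarrow> pathin X p \<and> p 0 = a \<and> p 1 = b"
  by (simp add: path_homotopic_def pathin_def)

lemma path_homotopic_sym: "path_homotopic X a b p q \<Longrightarrow> path_homotopic X a b q p"
  unfolding path_homotopic_def by (rule homotopic_with_symD)

lemma path_homotopic_trans [trans]:
  "path_homotopic X a b p q \<Longrightarrow> path_homotopic X a b q s \<Longrightarrow> path_homotopic X a b p s"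
  unfolding path_homotopic_def by (rule homotopic_with_trans)

lemma path_homotopic_left: "path_homotopic X a b p q \<Longrightarrow> path_homotopic X a b p p"
  by (meson path_homotopic_sym path_homotopic_trans)

lemma path_homotopic_eq:
  assumes "path_homotopic X a b p p" "\<And>x. x \<in> {0..1} \<Longrightarrow> p x = q x"
  shows "path_homotopic X a b p q"
  using assms unfolding path_homotopic_def
  by (intro homotopic_with_equal) auto

lemma path_homotopic_image:
  assumes "path_homotopic X a b p q" "continuous_map X Y f"
  shows "path_homotopic Y (f a) (f b) (f \<circ> p) (f \<circ> q)"
  using assms unfolding path_homotopic_def
  by (rule homotopic_with_compose_continuous_map_left) auto

lemma path_homotopic_rev:
  assumes "path_homotopic X a b p q"
  shows "path_homotopic X b a (path_rev p) (path_rev q)"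
proof -
  have "continuous_map (top_of_set {0..1}) (top_of_set {0..1}) (\<lambda>x::real. 1 - x)"
    by (auto intro!: continuous_intros)
  from homotopic_with_compose_continuous_map_right[OF assms[unfolded path_homotopic_def] this]
  show ?thesis unfolding path_homotopic_def path_rev_def by (auto simp: o_def)
qed

lemma path_homotopic_join:
  assumes "path_homotopic X a b p q" "path_homotopic X b c p' q'"
  shows "path_homotopic X a c (path_join p p') (path_join q q')"
proof -
  let ?I = "top_of_set {0..1::real}"
  from assms obtain h k where
      h: "continuous_map (prod_topology ?I ?I) X h" "\<And>x. h (0, x) = p x" "\<And>x. h (1, x) = q x"
         "\<And>t. t \<in> {0..1} \<Longrightarrow> h (t, 0) = a \<and> h (t, 1) = b"
    and k: "continuous_map (prod_topology ?I ?I) X k" "\<And>x. k (0, x) = p' x" "\<And>x. k (1, x) = q' x"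
         "\<And>t. t \<in> {0..1} \<Longrightarrow> k (t, 0) = b \<and> k (t, 1) = c"
    unfolding path_homotopic_def homotopic_with_def by blast
  have II: "prod_topology ?I ?I = top_of_set ({0..1} \<times> {0..1})"
    by (simp add: subtopology_Times)
  let ?h = "\<lambda>y::real \<times> real. if snd y \<le> 1/2 then (h \<circ> (\<lambda>y. (fst y, 2 * snd y))) y
                else (k \<circ> (\<lambda>y. (fst y, 2 * snd y - 1))) y"
  have "continuous_map (prod_topology ?I ?I) X ?h"
  proof (rule continuous_map_cases_le)
    show "continuous_map (prod_topology ?I ?I) euclideanreal snd"
      "continuous_map (prod_topology ?I ?I) euclideanreal (\<lambda>y. 1/2)"
      unfolding II by (auto intro!: continuous_intros)
    show "continuous_map (subtopology (prod_topology ?I ?I)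
        {y \<in> topspace (prod_topology ?I ?I). snd y \<le> 1 / 2}) X (h \<circ> (\<lambda>y. (fst y, 2 * snd y)))"
      by (rule continuous_map_compose[OF _ h(1)])
         (unfold II, auto simp: subtopology_subtopology intro!: continuous_intros)
    show "continuous_map (subtopology (prod_topology ?I ?I)
        {y \<in> topspace (prod_topology ?I ?I). 1 / 2 \<le> snd y}) X (k \<circ> (\<lambda>y. (fst y, 2 * snd y - 1)))"
      by (rule continuous_map_compose[OF _ k(1)])
         (unfold II, auto simp: subtopology_subtopology intro!: continuous_intros)
  next
    fix y :: "real \<times> real" assume y: "y \<in> topspace (prod_topology ?I ?I)" "snd y = 1 / 2"
    then obtain t where "y = (t, 1/2)" "t \<in> {0..1}" by (cases y) auto
    then show "(h \<circ> (\<lambda>y. (fst y, 2 * snd y))) y = (k \<circ> (\<lambda>y. (fst y, 2 * snd y - 1))) y"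
      using h(4)[of t] k(4)[of t] by simp
  qed
  then show ?thesis
    unfolding path_homotopic_def homotopic_with_def
    by (intro exI[of _ ?h]) (use h k in \<open>auto simp: path_join_def\<close>)
qed

text \<open>The groupoid laws below are instances of this lemma: their two sides run through one path,
  and the interval is convex.\<close>

lemma path_homotopic_reparam:
  assumes p: "pathin X p"
    and c: "continuous_on {0..1} \<phi>" "continuous_on {0..1} \<psi>"
    and i: "\<phi> ` {0..1} \<subseteq> {0..1}" "\<psi> ` {0..1} \<subseteq> {0..1}"
    and e: "\<phi> 0 = \<psi> 0" "\<phi> 1 = \<psi> 1"
  shows "path_homotopic X (p (\<phi> 0)) (p (\<phi> 1)) (p \<circ> \<phi>) (p \<circ> \<psi>)"
proof -
  let ?I = "top_of_set {0..1::real}"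
  have II: "prod_topology ?I ?I = top_of_set ({0..1} \<times> {0..1})"
    by (simp add: subtopology_Times)
  let ?g = "\<lambda>y. (1 - fst y) * \<phi> (snd y) + fst y * \<psi> (snd y)"
  have cs: "continuous_on ({0..1} \<times> {0..1}) (\<lambda>y. \<phi> (snd y))"
    "continuous_on ({0..1} \<times> {0..1}) (\<lambda>y. \<psi> (snd y))"
    by (auto intro!: continuous_on_compose2[OF c(1)] continuous_on_compose2[OF c(2)] continuous_intros)
  have "?g y \<in> {0..1}" if "y \<in> {0..1} \<times> {0..1}" for y
  proof -
    have "\<phi> (snd y) \<in> {0..1}" "\<psi> (snd y) \<in> {0..1}" "fst y \<in> {0..1}" using that i by auto
    then show ?thesis
      using convexD_alt[OF convex_closed_interval, of "\<phi> (snd y)" 0 1 "\<psi> (snd y)" "fst y"]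
      by (auto simp: cbox_interval)
  qed
  then have "continuous_map (prod_topology ?I ?I) ?I ?g"
    unfolding II by (auto intro!: continuous_intros cs)
  then have "continuous_map (prod_topology ?I ?I) X (p \<circ> ?g)"
    by (rule continuous_map_compose) (use p in \<open>simp add: pathin_def\<close>)
  then show ?thesis
    unfolding path_homotopic_def homotopic_with_def
    by (intro exI[of _ "p \<circ> ?g"]) (auto simp: e left_diff_distrib)
qed

text \<open>Both \<open>(p \<bullet> q\<inverse>) \<bullet> q\<close> and \<open>p\<close> are reparametrizations of \<open>p \<bullet> q\<inverse>\<close>: the former walks
  all the way and then back along the second half, the latter walks along the first half only.\<close>

lemma path_homotopic_join_rev_join:
  assumes "path_homotopic X a b p p" "path_homotopic X c b q q"
  shows "path_homotopic X a b (path_join (path_join p (path_rev q)) q) p"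
proof -
  let ?P = "path_join p (path_rev q)"
  let ?\<phi> = "\<lambda>x::real. if x \<le> 1/2 then 2 * x else 3/2 - x" and ?\<psi> = "\<lambda>x::real. x / 2"
  have P: "path_homotopic X a c ?P ?P"
    by (rule path_homotopic_join[OF assms(1) path_homotopic_rev[OF assms(2)]])
  have ends: "p 1 = b" "q 1 = b" using assms by (auto simp: path_homotopic_refl_iff)
  have "path_homotopic X (?P (?\<phi> 0)) (?P (?\<phi> 1)) (?P \<circ> ?\<phi>) (?P \<circ> ?\<psi>)"
  proof (rule path_homotopic_reparam)
    show "pathin X ?P" using P by (simp add: path_homotopic_refl_iff)
    show "continuous_on {0..1} ?\<phi>" by (intro continuous_on_cases_1 continuous_intros) auto
    show "continuous_on {0..1} ?\<psi>" by (intro continuous_intros) auto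
  qed auto
  then have *: "path_homotopic X a b (?P \<circ> ?\<phi>) (?P \<circ> ?\<psi>)"
    using assms by (auto simp: path_homotopic_refl_iff path_join_def)
  have \<phi>: "(?P \<circ> ?\<phi>) x = path_join ?P q x" if "x \<in> {0..1}" for x
    using that by (cases "x = 1") (auto simp: path_join_def path_rev_def ends)
  have \<psi>: "(?P \<circ> ?\<psi>) x = p x" if "x \<in> {0..1}" for x
    using that by (auto simp: path_join_def)
  have "path_homotopic X a b (path_join ?P q) (?P \<circ> ?\<phi>)"
    using path_homotopic_eq[OF path_homotopic_left[OF *] \<phi>] by (rule path_homotopic_sym)
  also note *
  also have "path_homotopic X a b (?P \<circ> ?\<psi>) p"
    using path_homotopic_eq[OF path_homotopic_left[OF path_homotopic_sym[OF *]] \<psi>] .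
  finally show ?thesis .
qed

lemma path_homotopic_join_rev:
  assumes "path_homotopic X a b p p"
  shows "path_homotopic X a a (path_join p (path_rev p)) (\<lambda>_. a)"
proof -
  let ?\<phi> = "\<lambda>x::real. if x \<le> 1/2 then 2 * x else 2 - 2 * x"
  have "path_homotopic X (p (?\<phi> 0)) (p (?\<phi> 1)) (p \<circ> ?\<phi>) (p \<circ> (\<lambda>_. 0))"
  proof (rule path_homotopic_reparam)
    show "pathin X p" using assms by (simp add: path_homotopic_refl_iff)
    show "continuous_on {0..1} ?\<phi>" by (intro continuous_on_cases_1 continuous_intros) auto
  qed auto
  moreover have "p \<circ> ?\<phi> = path_join p (path_rev p)"
    by (auto simp: path_join_def path_rev_def fun_eq_iff)
  ultimately show ?thesis using assms by (simp add: path_homotopic_refl_iff o_def)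
qed

lemma path_homotopic_const_join:
  assumes "path_homotopic X a b p p"
  shows "path_homotopic X a b (path_join (\<lambda>_. a) p) p"
proof -
  let ?\<phi> = "\<lambda>x::real. if x \<le> 1/2 then 0 else 2 * x - 1"
  have "path_homotopic X (p (?\<phi> 0)) (p (?\<phi> 1)) (p \<circ> ?\<phi>) (p \<circ> (\<lambda>x. x))"
  proof (rule path_homotopic_reparam)
    show "pathin X p" using assms by (simp add: path_homotopic_refl_iff)
    show "continuous_on {0..1} ?\<phi>" by (intro continuous_on_cases_1 continuous_intros) auto
  qed auto
  moreover have "p \<circ> ?\<phi> = path_join (\<lambda>_. a) p"
    using assms by (auto simp: path_join_def path_homotopic_refl_iff fun_eq_iff)
  ultimately show ?thesis using assms by (simp add: path_homotopic_refl_iff o_def)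
qed

text \<open>This turns a homotopy between paths into the triviality of a loop, which the fundamental group
  detects.\<close>

lemma path_homotopic_iff_loop:
  assumes "path_homotopic X a b p p" "path_homotopic X a b q q"
  shows "path_homotopic X a b p q \<longleftrightarrow> path_homotopic X a a (path_join p (path_rev q)) (\<lambda>_. a)"
proof
  assume "path_homotopic X a b p q"
  then have "path_homotopic X a a (path_join p (path_rev q)) (path_join q (path_rev q))"
    by (rule path_homotopic_join[OF _ path_homotopic_rev[OF assms(2)]])
  then show "path_homotopic X a a (path_join p (path_rev q)) (\<lambda>_. a)"
    by (rule path_homotopic_trans[OF _ path_homotopic_join_rev[OF assms(2)]])
next
  assume l: "path_homotopic X a a (path_join p (path_rev q)) (\<lambda>_. a)"
  have "path_homotopic X a b p (path_join (path_join p (path_rev q)) q)"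
    by (rule path_homotopic_sym[OF path_homotopic_join_rev_join[OF assms]])
  also have "path_homotopic X a b \<dots> (path_join (\<lambda>_. a) q)"
    by (rule path_homotopic_join[OF l assms(2)])
  also have "path_homotopic X a b \<dots> q"
    by (rule path_homotopic_const_join[OF assms(2)])
  finally show "path_homotopic X a b p q" .
qed

lemma image_path_join: "f \<circ> path_join p q = path_join (f \<circ> p) (f \<circ> q)"
  by (auto simp: path_join_def fun_eq_iff)

lemma image_path_rev: "f \<circ> path_rev p = path_rev (f \<circ> p)"
  by (auto simp: path_rev_def fun_eq_iff)


section \<open>Weak equivalences and fundamental groupoids\<close>

lemma htpy_class_eq_iff:
  assumes "f \<in> based_maps n X x" "g \<in> based_maps n X x"
  shows "htpy_class n X x f = htpy_class n X x g \<longleftrightarrow>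
    homotopic_with (\<lambda>h. h ` cube_boundary n \<subseteq> {x}) (cube n) X f g"
proof
  assume "htpy_class n X x f = htpy_class n X x g"
  moreover have "g \<in> htpy_class n X x g" using assms(2) by (simp add: htpy_class_def based_maps_def)
  ultimately show "homotopic_with (\<lambda>h. h ` cube_boundary n \<subseteq> {x}) (cube n) X f g"
    by (metis htpy_class_def mem_Collect_eq)
next
  assume h: "homotopic_with (\<lambda>h. h ` cube_boundary n \<subseteq> {x}) (cube n) X f g"
  show "htpy_class n X x f = htpy_class n X x g"
    unfolding htpy_class_def
    by (intro Collect_cong iffI)
       (erule homotopic_with_trans[OF homotopic_with_symD[OF h]] homotopic_with_trans[OF h])+
qed

lemma based_maps_image:
  assumes "continuous_map X Y f" "g \<in> based_maps n X x"
  shows "f \<circ> g \<in> based_maps n Y (f x)"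
  using assms by (auto simp: based_maps_def intro: continuous_map_compose)

text \<open>Composites with homotopic maps are homotopic, so all classes in the union coincide.\<close>

lemma htpy_class_image:
  assumes f: "continuous_map X Y f" and g: "g \<in> based_maps n X x"
  shows "(\<Union>g\<in>htpy_class n X x g. htpy_class n Y (f x) (f \<circ> g)) = htpy_class n Y (f x) (f \<circ> g)"
proof -
  have "htpy_class n Y (f x) (f \<circ> g') = htpy_class n Y (f x) (f \<circ> g)" if "g' \<in> htpy_class n X x g" for g'
  proof -
    have h: "homotopic_with (\<lambda>h. h ` cube_boundary n \<subseteq> {x}) (cube n) X g g'"
      using that by (simp add: htpy_class_def)
    have "g' \<in> based_maps n X x"
      using homotopic_with_imp_continuous_maps[OF h] homotopic_with_imp_property[OF h]
      by (simp add: based_maps_def)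
    moreover have "homotopic_with (\<lambda>h. h ` cube_boundary n \<subseteq> {f x}) (cube n) Y (f \<circ> g) (f \<circ> g')"
      by (rule homotopic_with_compose_continuous_map_left[OF h f]) auto
    ultimately show ?thesis
      using g htpy_class_eq_iff[OF based_maps_image[OF f g] based_maps_image[OF f, of g' n x]] by simp
  qed
  moreover have "g \<in> htpy_class n X x g" using g by (simp add: htpy_class_def based_maps_def)
  ultimately show ?thesis by blast
qed

lemma continuous_cube_interval:
  "continuous_map (cube 1) (top_of_set {0..1}) (\<lambda>t. t 0)"
  "continuous_map (top_of_set {0..1}) (cube 1) (\<lambda>x. \<lambda>i\<in>{..<1}. x)"
proof -
  show "continuous_map (cube 1) (top_of_set {0..1}) (\<lambda>t. t 0)"
    unfolding cube_def by (rule continuous_map_product_projection) simp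
  have "(\<lambda>x. (\<lambda>i\<in>{..<1::nat}. x) k) = (\<lambda>x::real. x)" if "k < 1" for k using that by simp
  then show "continuous_map (top_of_set {0..1}) (cube 1) (\<lambda>x. \<lambda>i\<in>{..<1}. x)"
    unfolding cube_def continuous_map_componentwise by auto
qed

lemma cube_1_eta: "t \<in> topspace (cube 1) \<Longrightarrow> (\<lambda>i\<in>{..<1}. t 0) = t"
  by (auto simp: cube_def PiE_def extensional_def fun_eq_iff)

lemma cube_boundary_1: "cube_boundary 1 = {\<lambda>i\<in>{..<1}. 0, \<lambda>i\<in>{..<1}. 1}"
proof
  show "cube_boundary 1 \<subseteq> {\<lambda>i\<in>{..<1}. 0, \<lambda>i\<in>{..<1}. 1}"
    using cube_1_eta by (force simp: cube_boundary_def)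
  show "{\<lambda>i\<in>{..<1}. 0, \<lambda>i\<in>{..<1}. 1} \<subseteq> cube_boundary 1"
    by (auto simp: cube_boundary_def cube_def)
qed

text \<open>Evaluation at the coordinate \<open>0\<close> identifies the 1-cube with the interval, and the boundary
  condition on the cube with the condition on the two end points.\<close>

lemma based_loop_homotopic_iff:
  "homotopic_with (\<lambda>h. h ` cube_boundary 1 \<subseteq> {x}) (cube 1) X (p \<circ> (\<lambda>t. t 0)) (q \<circ> (\<lambda>t. t 0))
    \<longleftrightarrow> path_homotopic X x x p q"
proof
  assume "path_homotopic X x x p q"
  then show "homotopic_with (\<lambda>h. h ` cube_boundary 1 \<subseteq> {x}) (cube 1) X (p \<circ> (\<lambda>t. t 0)) (q \<circ> (\<lambda>t. t 0))"
    unfolding path_homotopic_def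
    by (rule homotopic_with_compose_continuous_map_right[OF _ continuous_cube_interval(1)])
       (auto simp: cube_boundary_1 simp del: One_nat_def)
next
  assume "homotopic_with (\<lambda>h. h ` cube_boundary 1 \<subseteq> {x}) (cube 1) X (p \<circ> (\<lambda>t. t 0)) (q \<circ> (\<lambda>t. t 0))"
  from homotopic_with_compose_continuous_map_right[OF this continuous_cube_interval(2)]
  show "path_homotopic X x x p q"
    unfolding path_homotopic_def by (auto simp: cube_boundary_1 o_def simp del: One_nat_def)
qed

lemma based_loop_iff: "p \<circ> (\<lambda>t. t 0) \<in> based_maps 1 X x \<longleftrightarrow> path_homotopic X x x p p"
  using based_loop_homotopic_iff[of x X p p] by (simp add: based_maps_def)

lemma loop_of_based_map:
  assumes "g \<in> based_maps 1 X x"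
  obtains p where "path_homotopic X x x p p"
    "htpy_class 1 X x g = htpy_class 1 X x (p \<circ> (\<lambda>t. t 0))"
proof -
  let ?p = "\<lambda>s. g (\<lambda>i\<in>{..<1}. s)"
  have e: "g t = (?p \<circ> (\<lambda>t. t 0)) t" if "t \<in> topspace (cube 1)" for t
    using cube_1_eta[OF that] by simp
  have b: "cube_boundary 1 \<subseteq> topspace (cube 1)" by (auto simp: cube_boundary_def)
  have g: "continuous_map (cube 1) X g" "g ` cube_boundary 1 \<subseteq> {x}"
    using assms by (auto simp: based_maps_def simp del: One_nat_def)
  have "(?p \<circ> (\<lambda>t. t 0)) ` cube_boundary 1 = g ` cube_boundary 1"
    by (rule image_cong[OF refl]) (use b e in \<open>metis subsetD\<close>)
  then have p: "?p \<circ> (\<lambda>t. t 0) \<in> based_maps 1 X x"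
    using continuous_map_eq[OF g(1) e] g(2) unfolding based_maps_def by (simp add: o_def)
  have "homotopic_with (\<lambda>h. h ` cube_boundary 1 \<subseteq> {x}) (cube 1) X g (?p \<circ> (\<lambda>t. t 0))"
    using p g e by (intro homotopic_with_equal) (auto simp: based_maps_def simp del: One_nat_def)
  then have "htpy_class 1 X x g = htpy_class 1 X x (?p \<circ> (\<lambda>t. t 0))"
    using htpy_class_eq_iff[OF assms p] by simp
  then show thesis by (rule that[OF p[unfolded based_loop_iff]])
qed

text \<open>Injectivity on path components yields some path upstairs; bijectivity on fundamental groups, which
  only speaks of loops, can then be applied to loops formed with that path.\<close>

lemma weak_equivalence_top_path_reflect:
  assumes w: "weak_equivalence_top X Y f" and a: "a \<in> topspace X" and b: "b \<in> topspace X"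
    and p: "path_component_of Y (f a) (f b)"
  obtains p where "path_homotopic X a b p p"
proof -
  let ?F = "\<lambda>c. \<Union>x\<in>c. path_component_of_set Y (f x)"
  have f: "continuous_map X Y f" and inj: "inj_on ?F (path_components_of X)"
    using w by (auto simp: weak_equivalence_top_def bij_betw_def)
  have F: "?F (path_component_of_set X x) = path_component_of_set Y (f x)" if "x \<in> topspace X" for x
  proof -
    have "path_component_of_set Y (f x') = path_component_of_set Y (f x)" if x': "path_component_of X x x'" for x'
    proof -
      obtain g where "pathin X g" "g 0 = x" "g 1 = x'" using x' by (auto simp: path_component_of_def)
      then have "path_component_of Y (f x) (f x')"
        unfolding path_component_of_def by (intro exI[of _ "f \<circ> g"]) (simp add: pathin_compose f)
      then show ?thesis by (metis path_component_of_equiv)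
    qed
    moreover have "path_component_of X x x" using that by (simp add: path_component_of_refl)
    ultimately show ?thesis by blast
  qed
  have "?F (path_component_of_set X a) = ?F (path_component_of_set X b)"
    unfolding F[OF a] F[OF b] using p by (metis path_component_of_equiv)
  then have "path_component_of_set X a = path_component_of_set X b"
    by (rule inj_onD[OF inj]) (auto simp: path_components_of_def a b)
  then have "path_component_of X a b"
    using b by (metis mem_Collect_eq path_component_of_refl)
  then show thesis using that by (auto simp: path_component_of_def path_homotopic_refl_iff)
qed

text \<open>The loop that compares the two paths becomes trivial downstairs, hence is trivial upstairs by
  injectivity on fundamental groups.\<close>

lemma weak_equivalence_top_faithful:
  assumes w: "weak_equivalence_top X Y f"
    and p: "path_homotopic X a b p p" and q: "path_homotopic X a b q q"
    and fpq: "path_homotopic Y (f a) (f b) (f \<circ> p) (f \<circ> q)"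
  shows "path_homotopic X a b p q"
proof -
  let ?F = "\<lambda>c. \<Union>g\<in>c. htpy_class 1 Y (f a) (f \<circ> g)" and ?e = "\<lambda>t::nat \<Rightarrow> real. t 0"
  have f: "continuous_map X Y f" using w by (simp add: weak_equivalence_top_def)
  have a: "a \<in> topspace X"
    using p path_start_in_topspace[of X p] by (auto simp: path_homotopic_refl_iff)
  have inj: "inj_on ?F (htpy_group 1 X a)"
    using w a by (auto simp: weak_equivalence_top_def bij_betw_def)
  let ?l = "path_join p (path_rev q)" and ?c = "\<lambda>_::real. a"
  have l: "path_homotopic X a a ?l ?l" by (rule path_homotopic_join[OF p path_homotopic_rev[OF q]])
  have c: "path_homotopic X a a ?c ?c" using a by (simp add: path_homotopic_refl_iff)
  note lc = based_loop_iff[THEN iffD2, OF l] based_loop_iff[THEN iffD2, OF c]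
  have "path_homotopic Y (f a) (f a) (f \<circ> ?l) (\<lambda>_. f a)"
    using path_homotopic_iff_loop[THEN iffD1, OF path_homotopic_image[OF p f] path_homotopic_image[OF q f] fpq]
    by (simp add: image_path_join image_path_rev)
  then have "homotopic_with (\<lambda>h. h ` cube_boundary 1 \<subseteq> {f a}) (cube 1) Y (f \<circ> (?l \<circ> ?e)) (f \<circ> (?c \<circ> ?e))"
    using based_loop_homotopic_iff[of "f a" Y "f \<circ> ?l" "\<lambda>_. f a"] by (simp add: o_def)
  then have "?F (htpy_class 1 X a (?l \<circ> ?e)) = ?F (htpy_class 1 X a (?c \<circ> ?e))"
    unfolding htpy_class_image[OF f lc(1)] htpy_class_image[OF f lc(2)]
    using htpy_class_eq_iff[OF based_maps_image[OF f lc(1)] based_maps_image[OF f lc(2)]] by simp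
  then have "htpy_class 1 X a (?l \<circ> ?e) = htpy_class 1 X a (?c \<circ> ?e)"
    by (rule inj_onD[OF inj]) (use lc in \<open>auto simp: htpy_group_def simp del: One_nat_def\<close>)
  then have "path_homotopic X a a ?l ?c"
    unfolding htpy_class_eq_iff[OF lc] based_loop_homotopic_iff .
  then show ?thesis using path_homotopic_iff_loop[OF p q] by simp
qed

lemma weak_equivalence_top_full:
  assumes w: "weak_equivalence_top X Y f" and a: "a \<in> topspace X" and b: "b \<in> topspace X"
    and s: "path_homotopic Y (f a) (f b) s s"
  obtains p where "path_homotopic X a b p p" "path_homotopic Y (f a) (f b) (f \<circ> p) s"
proof -
  let ?F = "\<lambda>c. \<Union>g\<in>c. htpy_class 1 Y (f a) (f \<circ> g)" and ?e = "\<lambda>t::nat \<Rightarrow> real. t 0"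
  have f: "continuous_map X Y f" using w by (simp add: weak_equivalence_top_def)
  have surj: "?F ` htpy_group 1 X a = htpy_group 1 Y (f a)"
    using w a by (auto simp: weak_equivalence_top_def bij_betw_def)
  \<comment> \<open>The image of any path \<open>p0\<close> differs from \<open>s\<close> by a loop, and loops lift up to homotopy.\<close>
  obtain p0 where p0: "path_homotopic X a b p0 p0"
    using weak_equivalence_top_path_reflect[OF w a b] s
    by (auto simp: path_component_of_def path_homotopic_refl_iff)
  note fp0 = path_homotopic_image[OF p0 f]
  let ?l = "path_join s (path_rev (f \<circ> p0))"
  have l: "path_homotopic Y (f a) (f a) ?l ?l"
    by (rule path_homotopic_join[OF s path_homotopic_rev[OF fp0]])
  then have "?l \<circ> ?e \<in> based_maps 1 Y (f a)" by (simp only: based_loop_iff)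
  then have "htpy_class 1 Y (f a) (?l \<circ> ?e) \<in> ?F ` htpy_group 1 X a"
    unfolding surj by (unfold htpy_group_def, rule imageI)
  then obtain c where c: "htpy_class 1 Y (f a) (?l \<circ> ?e) = ?F c" "c \<in> htpy_group 1 X a"
    by (rule imageE)
  from c(2)[unfolded htpy_group_def] obtain g where g: "c = htpy_class 1 X a g" "g \<in> based_maps 1 X a"
    by (rule imageE)
  obtain m where m: "path_homotopic X a a m m" "htpy_class 1 X a g = htpy_class 1 X a (m \<circ> ?e)"
    using loop_of_based_map[OF g(2)] .
  note m' = based_loop_iff[THEN iffD2, OF m(1)]
  have "htpy_class 1 Y (f a) (f \<circ> (m \<circ> ?e)) = htpy_class 1 Y (f a) (?l \<circ> ?e)"
    unfolding c(1) g(1) m(2) htpy_class_image[OF f m'] ..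
  then have "homotopic_with (\<lambda>h. h ` cube_boundary 1 \<subseteq> {f a}) (cube 1) Y ((f \<circ> m) \<circ> ?e) (?l \<circ> ?e)"
    using htpy_class_eq_iff[OF based_maps_image[OF f m'] based_loop_iff[THEN iffD2, OF l]]
    by (simp add: o_assoc)
  then have "path_homotopic Y (f a) (f a) (f \<circ> m) ?l" unfolding based_loop_homotopic_iff .
  then have "path_homotopic Y (f a) (f b) (path_join (f \<circ> m) (f \<circ> p0)) (path_join ?l (f \<circ> p0))"
    by (rule path_homotopic_join[OF _ fp0])
  also have "path_homotopic Y (f a) (f b) \<dots> s" by (rule path_homotopic_join_rev_join[OF s fp0])
  finally have "path_homotopic Y (f a) (f b) (f \<circ> path_join m p0) s" unfolding image_path_join .
  then show thesis by (rule that[OF path_homotopic_join[OF m(1) p0]])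
qed


section \<open>Geometric realization\<close>

lemma openin_realization:
  "openin (realization X) U \<longleftrightarrow> U \<subseteq> real_pt X ` topspace (cells_top X) \<and>
     openin (cells_top X) {p \<in> topspace (cells_top X). real_pt X p \<in> U}"
  unfolding realization_def by (simp add: topology_inverse'[OF istopology_realization])

lemma topspace_cells_top:
  "topspace (cells_top X) = (SIGMA n:UNIV. simplices X n \<times> standard_simplex n)"
  by (auto simp: cells_top_def simplex_top_def topspace_standard_simplex)

lemma topspace_realization: "topspace (realization X) = real_pt X ` topspace (cells_top X)"
proof
  show "topspace (realization X) \<subseteq> real_pt X ` topspace (cells_top X)"
    using openin_realization[of X "topspace (realization X)"] by simp
  have "{p \<in> topspace (cells_top X). real_pt X p \<in> real_pt X ` topspace (cells_top X)} = topspace (cells_top X)"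
    by auto
  then have "openin (realization X) (real_pt X ` topspace (cells_top X))"
    unfolding openin_realization by (metis openin_topspace order_refl)
  then show "real_pt X ` topspace (cells_top X) \<subseteq> topspace (realization X)"
    by (rule openin_subset)
qed

lemma real_pt_in_realization:
  "s \<in> simplices X n \<Longrightarrow> t \<in> standard_simplex n \<Longrightarrow> real_pt X (n, s, t) \<in> topspace (realization X)"
  unfolding topspace_realization topspace_cells_top by (rule imageI) simp

lemma openin_prod_discrete:
  "openin (prod_topology (discrete_topology S) T) V \<longleftrightarrow>
     V \<subseteq> S \<times> topspace T \<and> (\<forall>s\<in>S. openin T {t. (s, t) \<in> V})"
proof safe
  fix a b assume o: "openin (prod_topology (discrete_topology S) T) V"
  have V: "V \<subseteq> S \<times> topspace T" using openin_subset[OF o] by simp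
  {
    assume "(a, b) \<in> V" then show "a \<in> S" "b \<in> topspace T" using V by auto
  }
  fix s assume s: "s \<in> S"
  have "continuous_map T (prod_topology (discrete_topology S) T) (\<lambda>t. (s, t))"
    using s by (intro continuous_map_pairedI) auto
  from openin_continuous_map_preimage[OF this o]
  have "openin T {t \<in> topspace T. (s, t) \<in> V}" .
  moreover have "{t \<in> topspace T. (s, t) \<in> V} = {t. (s, t) \<in> V}" using V by auto
  ultimately show "openin T {t. (s, t) \<in> V}" by simp
next
  assume V: "V \<subseteq> S \<times> topspace T" and o: "\<forall>s\<in>S. openin T {t. (s, t) \<in> V}"
  have "V = (\<Union>s\<in>S. {s} \<times> {t. (s, t) \<in> V})" using V by auto
  moreover have "openin (prod_topology (discrete_topology S) T) (\<Union>s\<in>S. {s} \<times> {t. (s, t) \<in> V})"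
    using o by (intro openin_Union) (auto simp: openin_prod_Times_iff)
  ultimately show "openin (prod_topology (discrete_topology S) T) V" by simp
qed

lemma openin_cells_top:
  "openin (cells_top X) W \<longleftrightarrow> W \<subseteq> topspace (cells_top X) \<and>
     (\<forall>n. \<forall>s\<in>simplices X n. openin (simplex_top n) {t. (n, s, t) \<in> W})"
  unfolding cells_top_def openin_sum_topology openin_prod_discrete topspace_sum_topology
  by (auto simp: simplex_top_def)

lemma continuous_map_in_topspace: "continuous_map X Y f \<Longrightarrow> x \<in> topspace X \<Longrightarrow> f x \<in> topspace Y"
  by (drule continuous_map_funspace) (rule funcset_mem)

lemma continuous_map_cell:
  assumes "s \<in> simplices X n"
  shows "continuous_map (simplex_top n) (realization X) (\<lambda>t. real_pt X (n, s, t))"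
  unfolding continuous_map_def
proof (intro conjI allI impI)
  have ts: "topspace (simplex_top n) = standard_simplex n"
    by (simp add: simplex_top_def topspace_standard_simplex)
  show "(\<lambda>t. real_pt X (n, s, t)) \<in> topspace (simplex_top n) \<rightarrow> topspace (realization X)"
    by (auto simp: ts intro: real_pt_in_realization[OF assms])
  fix U assume "openin (realization X) U"
  then have "openin (simplex_top n) {t. (n, s, t) \<in> {p \<in> topspace (cells_top X). real_pt X p \<in> U}}"
    using assms by (simp add: openin_realization openin_cells_top)
  moreover have "{t. (n, s, t) \<in> {p \<in> topspace (cells_top X). real_pt X p \<in> U}}
      = {t \<in> topspace (simplex_top n). real_pt X (n, s, t) \<in> U}"
    using assms by (auto simp: topspace_cells_top ts)
  ultimately show "openin (simplex_top n) {t \<in> topspace (simplex_top n). real_pt X (n, s, t) \<in> U}"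
    by simp
qed

text \<open>A realization carries a quotient topology, so continuity may be tested on each simplex separately.\<close>

lemma continuous_map_from_realization:
  assumes "\<And>n s. s \<in> simplices X n \<Longrightarrow> continuous_map (simplex_top n) T (\<lambda>t. F (real_pt X (n, s, t)))"
  shows "continuous_map (realization X) T F"
  unfolding continuous_map_def
proof (intro conjI allI impI)
  have ts: "topspace (simplex_top n) = standard_simplex n" for n
    by (simp add: simplex_top_def topspace_standard_simplex)
  have "F (real_pt X (n, s, t)) \<in> topspace T" if "s \<in> simplices X n" "t \<in> standard_simplex n" for n s t
    using continuous_map_in_topspace[OF assms[OF that(1)]] that(2) by (simp add: ts)
  then show "F \<in> topspace (realization X) \<rightarrow> topspace T"
    by (auto simp: topspace_realization topspace_cells_top)
  fix U assume U: "openin T U"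
  let ?V = "{c \<in> topspace (realization X). F c \<in> U}"
  have "openin (simplex_top n) {t. (n, s, t) \<in> {p \<in> topspace (cells_top X). real_pt X p \<in> ?V}}"
    if s: "s \<in> simplices X n" for n s
  proof -
    have "{t. (n, s, t) \<in> {p \<in> topspace (cells_top X). real_pt X p \<in> ?V}}
        = {t \<in> topspace (simplex_top n). F (real_pt X (n, s, t)) \<in> U}"
      using s real_pt_in_realization by (auto simp: topspace_cells_top ts)
    then show ?thesis using openin_continuous_map_preimage[OF assms[OF s] U] by simp
  qed
  then show "openin (realization X) ?V"
    unfolding openin_realization openin_cells_top by (auto simp: topspace_realization)
qed

lemma real_pt_glue:
  assumes "\<alpha> \<in> Delta m n" "s \<in> simplices X n" "t \<in> standard_simplex m"
  shows "real_pt X (m, act X m n \<alpha> s, t) = real_pt X (n, s, push_coords m \<alpha> t)"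
proof -
  have "equivclp (glue X) (m, act X m n \<alpha> s, t) (n, s, push_coords m \<alpha> t)"
    by (rule r_into_equivclp) (use assms in \<open>auto simp: glue_def\<close>)
  then show ?thesis
    unfolding real_pt_def by (auto intro: equivclp_trans equivclp_sym)
qed

lemma glue_invariant:
  assumes inv: "\<And>p q. glue X p q \<Longrightarrow> F p = F q" and q: "q \<in> real_pt X p"
  shows "F q = F p"
proof -
  have "equivclp (glue X) p q" using q by (simp add: real_pt_def)
  then show ?thesis by (induction rule: equivclp_induct) (auto dest: inv)
qed

lemma real_pt_self: "p \<in> real_pt X p"
  by (simp add: real_pt_def)

text \<open>A simplicial map respects the gluing, so the union defining its realization is a single point.\<close>

lemma realize_map_real_pt:
  assumes f: "smap X Y f"
  shows "realize_map Y f (real_pt X (n, s, t)) = real_pt Y (n, f n s, t)"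
proof -
  let ?F = "\<lambda>(n, s, t). real_pt Y (n, f n s, t)"
  have "?F p = ?F q" if glue: "glue X p q" for p q
  proof -
    obtain m n \<alpha> s t where *: "\<alpha> \<in> Delta m n" "s \<in> simplices X n" "t \<in> standard_simplex m"
        "p = (m, act X m n \<alpha> s, t)" "q = (n, s, push_coords m \<alpha> t)"
      using glue unfolding glue_def by blast
    moreover have "f n s \<in> simplices Y n" "f m (act X m n \<alpha> s) = act Y m n \<alpha> (f n s)"
      using f * by (auto simp: smap_def)
    ultimately show ?thesis using real_pt_glue[of \<alpha> m n "f n s" Y t] by simp
  qed
  then have "?F q = ?F (n, s, t)" if "q \<in> real_pt X (n, s, t)" for q
    using glue_invariant[of X ?F q "(n, s, t)"] that by blast
  then have "(\<Union>q\<in>real_pt X (n, s, t). ?F q) = ?F (n, s, t)"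
    using real_pt_self[of "(n, s, t)" X] by blast
  then show ?thesis by (simp add: realize_map_def)
qed

lemma continuous_realize_map:
  assumes "smap X Y f"
  shows "continuous_map (realization X) (realization Y) (realize_map Y f)"
  by (rule continuous_map_from_realization)
     (use assms in \<open>auto simp: realize_map_real_pt[OF assms] smap_def intro: continuous_map_cell\<close>)

definition vertex_pt :: "'a sset \<Rightarrow> 'a \<Rightarrow> (nat \<times> 'a \<times> (nat \<Rightarrow> real)) set" where
  "vertex_pt X v = real_pt X (0, v, \<lambda>i. if i = 0 then 1 else 0)"

definition edge_path :: "'a sset \<Rightarrow> 'a \<Rightarrow> real \<Rightarrow> (nat \<times> 'a \<times> (nat \<Rightarrow> real)) set" where
  "edge_path X e = (\<lambda>x. real_pt X (1, e, \<lambda>i. if i = 0 then 1 - x else if i = 1 then x else 0))"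

lemma realize_map_vertex_pt: "smap X Y f \<Longrightarrow> realize_map Y f (vertex_pt X v) = vertex_pt Y (f 0 v)"
  by (simp add: vertex_pt_def realize_map_real_pt)

lemma realize_map_edge_path: "smap X Y f \<Longrightarrow> realize_map Y f \<circ> edge_path X e = edge_path Y (f 1 e)"
  by (auto simp: edge_path_def realize_map_real_pt)

lemma vertex_pt_in_realization: "v \<in> simplices X 0 \<Longrightarrow> vertex_pt X v \<in> topspace (realization X)"
  unfolding vertex_pt_def by (rule real_pt_in_realization) (auto simp: standard_simplex_0)

lemma const_op_Delta: "i \<le> n \<Longrightarrow> const_op m i \<in> Delta m n"
  by (auto simp: const_op_def Delta_def mono_on_def)

lemma push_coords_vertex:
  assumes "t \<in> standard_simplex 0"
  shows "push_coords 0 (const_op 0 i) t = (\<lambda>j. if j = i then 1 else 0)"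
proof -
  have "{k. k \<le> 0 \<and> const_op 0 i k = j} = (if j = i then {0} else {})" for j
    by (auto simp: const_op_def)
  then show ?thesis
    using assms by (auto simp: push_coords_def standard_simplex_0 fun_eq_iff)
qed

lemma vertex_pt_face:
  assumes "e \<in> simplices X n" "i \<le> n"
  shows "vertex_pt X (act X 0 n (const_op 0 i) e) = real_pt X (n, e, \<lambda>j. if j = i then 1 else 0)"
proof -
  let ?t = "\<lambda>i::nat. if i = 0 then 1 else 0 :: real"
  have "?t \<in> standard_simplex 0" by (simp add: standard_simplex_0)
  then show ?thesis
    using real_pt_glue[OF const_op_Delta[OF assms(2)] assms(1)] push_coords_vertex
    by (simp add: vertex_pt_def)
qed

lemma edge_path_homotopic_refl:
  assumes e: "e \<in> simplices X 1"
  shows "path_homotopic (realization X) (vertex_pt X (act X 0 1 (const_op 0 0) e))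
    (vertex_pt X (act X 0 1 (const_op 0 1) e)) (edge_path X e) (edge_path X e)"
proof -
  let ?l = "\<lambda>(x::real) i::nat. if i = 0 then 1 - x else if i = 1 then x else 0"
  have "continuous_on {0..1} (\<lambda>x. ?l x k)" for k
    by (cases "k = 0"; cases "k = 1") (auto intro!: continuous_intros)
  then have "continuous_map (top_of_set {0..1}) (powertop_real UNIV) ?l"
    unfolding continuous_map_componentwise_UNIV continuous_map_iff_continuous by blast
  moreover have "?l x \<in> standard_simplex 1" if "x \<in> {0..1}" for x
    using that by (auto simp: standard_simplex_def)
  ultimately have "continuous_map (top_of_set {0..1}) (simplex_top 1) ?l"
    by (auto simp: simplex_top_def continuous_map_in_subtopology)
  from continuous_map_compose[OF this continuous_map_cell[OF e]]
  have "pathin (realization X) (edge_path X e)"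
    by (simp add: pathin_def edge_path_def o_def)
  moreover have "edge_path X e 0 = vertex_pt X (act X 0 1 (const_op 0 0) e)"
    unfolding vertex_pt_face[OF e le0] edge_path_def by (rule arg_cong[where f = "\<lambda>t. real_pt X (1, e, t)"]) auto
  moreover have "edge_path X e 1 = vertex_pt X (act X 0 1 (const_op 0 1) e)"
    unfolding vertex_pt_face[OF e order_refl] edge_path_def by (rule arg_cong[where f = "\<lambda>t. real_pt X (1, e, t)"]) auto
  ultimately show ?thesis by (simp add: path_homotopic_refl_iff)
qed

text \<open>Every simplex of a one-point simplicial set is degenerate, hence glued to the vertex.\<close>

lemma topspace_realization_point:
  "topspace (realization (discrete_sset {a})) = {vertex_pt (discrete_sset {a}) a}"
proof -
  let ?X = "discrete_sset {a}"
  have a: "a \<in> simplices ?X n" for n by (simp add: discrete_sset_def)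
  have "real_pt ?X (n, a, t) = vertex_pt ?X a" if t: "t \<in> standard_simplex n" for n t
  proof -
    have "push_coords n (const_op n 0) t \<in> standard_simplex 0"
      by (rule push_coords_in[OF const_op_Delta t]) simp
    then show ?thesis
      using real_pt_glue[OF const_op_Delta[OF le0] a t]
      by (simp add: discrete_sset_def vertex_pt_def standard_simplex_0)
  qed
  then have "topspace (realization ?X) \<subseteq> {vertex_pt ?X a}"
    unfolding topspace_realization topspace_cells_top by (force simp: discrete_sset_def[of "{a}"])
  then show ?thesis using vertex_pt_in_realization[OF a] by blast
qed


section \<open>Self-adjoint paths\<close>

definition realized_dag :: "('o, 'a) dscat \<Rightarrow> 'o \<Rightarrow> (nat \<times> 'a \<times> (nat \<Rightarrow> real)) set \<Rightarrow> (nat \<times> 'a \<times> (nat \<Rightarrow> real)) set" where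
  "realized_dag C x = realize_map (maps C x x) (dag C x x)"

text \<open>The self-adjoint endomorphism \<open>u\<^sup>\<dagger> u\<close>, in every dimension, so that it can be formed from an
  edge as well.\<close>

definition norm_sq :: "('o, 'a) dscat \<Rightarrow> 'o \<Rightarrow> 'o \<Rightarrow> nat \<Rightarrow> 'a \<Rightarrow> 'a" where
  "norm_sq C x y n u = cmp C x y x n (dag C x y n u) u"

context dagger_scat
begin

lemma dag_closed: "\<lbrakk>x \<in> obj C; y \<in> obj C; f \<in> mor C x y n\<rbrakk> \<Longrightarrow> dag C x y n f \<in> mor C y x n"
  using dag_smap by (auto simp: smap_def)

lemma dag_act:
  "\<lbrakk>x \<in> obj C; y \<in> obj C; \<alpha> \<in> Delta m n; f \<in> mor C x y n\<rbrakk>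
    \<Longrightarrow> dag C x y m (act (maps C x y) m n \<alpha> f) = act (maps C y x) m n \<alpha> (dag C x y n f)"
  using dag_smap by (auto simp: smap_def)

lemma norm_sq_closed: "\<lbrakk>x \<in> obj C; y \<in> obj C; u \<in> mor C x y n\<rbrakk> \<Longrightarrow> norm_sq C x y n u \<in> mor C x x n"
  unfolding norm_sq_def by (intro cmp_closed dag_closed)

lemma dag_norm_sq:
  "\<lbrakk>x \<in> obj C; y \<in> obj C; u \<in> mor C x y n\<rbrakk> \<Longrightarrow> dag C x x n (norm_sq C x y n u) = norm_sq C x y n u"
  unfolding norm_sq_def by (simp add: dag_cmp dag_dag dag_closed)

lemma norm_sq_act:
  "\<lbrakk>x \<in> obj C; y \<in> obj C; \<alpha> \<in> Delta m n; u \<in> mor C x y n\<rbrakk>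
    \<Longrightarrow> norm_sq C x y m (act (maps C x y) m n \<alpha> u) = act (maps C x x) m n \<alpha> (norm_sq C x y n u)"
  unfolding norm_sq_def by (simp add: cmp_act dag_act dag_closed)

lemma continuous_realized_dag:
  "x \<in> obj C \<Longrightarrow> continuous_map (realization (maps C x x)) (realization (maps C x x)) (realized_dag C x)"
  unfolding realized_dag_def by (intro continuous_realize_map dag_smap)

lemma realized_dag_vertex_pt:
  "\<lbrakk>x \<in> obj C; dag C x x 0 v = v\<rbrakk> \<Longrightarrow> realized_dag C x (vertex_pt (maps C x x) v) = vertex_pt (maps C x x) v"
  unfolding realized_dag_def by (simp add: realize_map_vertex_pt dag_smap)

text \<open>An edge \<open>e\<close> from \<open>u\<close> to \<open>v\<close> yields the edge \<open>e\<^sup>\<dagger> e\<close> from \<open>u\<^sup>\<dagger> u\<close> to \<open>v\<^sup>\<dagger> v\<close>,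
  whose points are all self-adjoint. So replacing \<open>u\<close> by another representative of its class moves
  \<open>u\<^sup>\<dagger> u\<close> along a path that the dagger fixes pointwise.\<close>

lemma self_adjoint_path_norm_sq:
  assumes x: "x \<in> obj C" and y: "y \<in> obj C" and u: "u \<in> mor C x y 0"
    and v: "v \<in> pi0_class (maps C x y) u"
  obtains p where "path_homotopic (realization (maps C x x)) (vertex_pt (maps C x x) (norm_sq C x y 0 u))
      (vertex_pt (maps C x x) (norm_sq C x y 0 v)) p p"
    "realized_dag C x \<circ> p = p"
proof -
  let ?X = "maps C x x" and ?R = "\<lambda>a b. \<exists>e\<in>mor C x y 1.
      a = act (maps C x y) 0 1 (const_op 0 0) e \<and> b = act (maps C x y) 0 1 (const_op 0 1) e"
  let ?n = "\<lambda>w. vertex_pt ?X (norm_sq C x y 0 w)"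
  let ?P = "\<lambda>a b p. path_homotopic (realization ?X) (?n a) (?n b) p p \<and> realized_dag C x \<circ> p = p"
  have edge: "\<exists>p. ?P a b p" if ab: "?R a b" for a b
  proof -
    obtain e where e: "e \<in> mor C x y 1"
      "a = act (maps C x y) 0 1 (const_op 0 0) e" "b = act (maps C x y) 0 1 (const_op 0 1) e"
      using ab by blast
    let ?e = "norm_sq C x y 1 e"
    have "norm_sq C x y 0 a = act ?X 0 1 (const_op 0 0) ?e" "norm_sq C x y 0 b = act ?X 0 1 (const_op 0 1) ?e"
      unfolding e(2,3) by (intro norm_sq_act x y e(1) const_op_Delta; simp)+
    moreover have "realized_dag C x \<circ> edge_path ?X ?e = edge_path ?X ?e"
      unfolding realized_dag_def realize_map_edge_path[OF dag_smap[OF x x]]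
      by (simp only: dag_norm_sq[OF x y e(1)])
    ultimately show ?thesis
      using edge_path_homotopic_refl[OF norm_sq_closed[OF x y e(1)]] by auto
  qed
  have inv: "\<exists>p. ?P b a p" if "\<exists>p. ?P a b p" for a b
  proof -
    from that obtain p where p: "path_homotopic (realization ?X) (?n a) (?n b) p p" "realized_dag C x \<circ> p = p"
      by blast
    show ?thesis
      using path_homotopic_rev[OF p(1)] image_path_rev[of "realized_dag C x" p] p(2)
      by (intro exI[of _ "path_rev p"]) simp
  qed
  have "equivclp ?R u v" using v by (simp add: pi0_class_def)
  then have "\<exists>p. ?P u v p"
  proof (induction rule: equivclp_induct)
    case base
    have "?n u \<in> topspace (realization ?X)"
      by (rule vertex_pt_in_realization[OF norm_sq_closed[OF x y u]])
    then show ?case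
      using realized_dag_vertex_pt[OF x dag_norm_sq[OF x y u]]
      by (intro exI[of _ "\<lambda>_. ?n u"]) (auto simp: path_homotopic_refl_iff)
  next
    case (step b c)
    from step(2) have "\<exists>q. ?P b c q" using edge[of b c] inv[OF edge[of c b]] by blast
    then obtain q where q: "path_homotopic (realization ?X) (?n b) (?n c) q q" "realized_dag C x \<circ> q = q"
      by blast
    from step(3) obtain p where p: "path_homotopic (realization ?X) (?n u) (?n b) p p" "realized_dag C x \<circ> p = p"
      by blast
    show ?case
      using path_homotopic_join[OF p(1) q(1)] image_path_join[of "realized_dag C x" p q] p(2) q(2)
      by (intro exI[of _ "path_join p q"]) simp
  qed
  then show thesis using that by blast
qed

end

context dagger_functor
begin

lemma F_closed: "\<lbrakk>x \<in> obj A; y \<in> obj A; f \<in> mor A x y n\<rbrakk> \<Longrightarrow> F x y n f \<in> mor B x y n"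
  using F_smap by (auto simp: smap_def)

lemma F_norm_sq:
  "\<lbrakk>x \<in> obj A; y \<in> obj A; u \<in> mor A x y n\<rbrakk> \<Longrightarrow> F x x n (norm_sq A x y n u) = norm_sq B x y n (F x y n u)"
  unfolding norm_sq_def by (simp add: F_cmp F_dag A.dag_closed)

lemma realize_F_dag:
  assumes x: "x \<in> obj A" and c: "c \<in> topspace (realization (maps A x x))"
  shows "realize_map (maps B x x) (F x x) (realized_dag A x c)
    = realized_dag B x (realize_map (maps B x x) (F x x) c)"
proof -
  have xB: "x \<in> obj B" using x obj_eq by simp
  obtain n s t where "c = real_pt (maps A x x) (n, s, t)" "s \<in> mor A x x n"
    using c by (auto simp: topspace_realization topspace_cells_top)
  then show ?thesis
    unfolding realized_dag_def
    by (simp add: realize_map_real_pt[OF F_smap[OF x x]] realize_map_real_pt[OF A.dag_smap[OF x x]]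
        realize_map_real_pt[OF B.dag_smap[OF xB xB]] F_dag[OF x x])
qed

lemma realize_F_dag_path:
  assumes x: "x \<in> obj A" and p: "path_homotopic (realization (maps A x x)) a b p p"
  shows "path_homotopic (realization (maps B x x)) (realize_map (maps B x x) (F x x) (realized_dag A x a))
    (realize_map (maps B x x) (F x x) (realized_dag A x b))
    (realize_map (maps B x x) (F x x) \<circ> (realized_dag A x \<circ> p))
    (realized_dag B x \<circ> (realize_map (maps B x x) (F x x) \<circ> p))"
proof (rule path_homotopic_eq)
  show "path_homotopic (realization (maps B x x)) (realize_map (maps B x x) (F x x) (realized_dag A x a))
    (realize_map (maps B x x) (F x x) (realized_dag A x b))
    (realize_map (maps B x x) (F x x) \<circ> (realized_dag A x \<circ> p))
    (realize_map (maps B x x) (F x x) \<circ> (realized_dag A x \<circ> p))"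
    by (rule path_homotopic_image[OF path_homotopic_image[OF p A.continuous_realized_dag[OF x]]
        continuous_realize_map[OF F_smap[OF x x]]])
  fix s :: real assume "s \<in> {0..1}"
  moreover have "pathin (realization (maps A x x)) p" using p by (simp add: path_homotopic_refl_iff)
  ultimately have "p s \<in> topspace (realization (maps A x x))"
    unfolding pathin_def by (intro continuous_map_in_topspace[where f = p]) auto
  then show "(realize_map (maps B x x) (F x x) \<circ> (realized_dag A x \<circ> p)) s
      = (realized_dag B x \<circ> (realize_map (maps B x x) (F x x) \<circ> p)) s"
    by (simp add: realize_F_dag[OF x])
qed

text \<open>Being homotopic to its own dagger is a property of a path that a weak equivalence of
  endomorphism spaces reflects, because the induced functor of fundamental groupoids is fully faithful
  and commutes with the dagger.\<close>

lemma lift_self_adjoint_path: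
  assumes x: "x \<in> obj A"
    and w: "weak_equivalence (maps A x x) (maps B x x) (F x x)"
    and a: "a \<in> mor A x x 0" "dag A x x 0 a = a" and b: "b \<in> mor A x x 0" "dag A x x 0 b = b"
    and s: "path_homotopic (realization (maps B x x)) (vertex_pt (maps B x x) (F x x 0 a))
      (vertex_pt (maps B x x) (F x x 0 b)) s (realized_dag B x \<circ> s)"
  obtains p where "path_homotopic (realization (maps A x x)) (vertex_pt (maps A x x) a)
    (vertex_pt (maps A x x) b) p (realized_dag A x \<circ> p)"
proof -
  let ?X = "realization (maps A x x)" and ?Y = "realization (maps B x x)"
  let ?f = "realize_map (maps B x x) (F x x)"
  let ?a = "vertex_pt (maps A x x) a" and ?b = "vertex_pt (maps A x x) b"
  have xB: "x \<in> obj B" using x obj_eq by simp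
  have w': "weak_equivalence_top ?X ?Y ?f" using w by (simp add: weak_equivalence_def)
  have f: "?f ?a = vertex_pt (maps B x x) (F x x 0 a)" "?f ?b = vertex_pt (maps B x x) (F x x 0 b)"
    by (simp_all add: realize_map_vertex_pt[OF F_smap[OF x x]])
  have ab: "?a \<in> topspace ?X" "?b \<in> topspace ?X"
    using a b by (simp_all add: vertex_pt_in_realization)
  have d: "realized_dag A x ?a = ?a" "realized_dag A x ?b = ?b"
    using a b x by (simp_all add: A.realized_dag_vertex_pt)
  have dB: "realized_dag B x (?f ?a) = ?f ?a" "realized_dag B x (?f ?b) = ?f ?b"
    using realize_F_dag[OF x ab(1)] realize_F_dag[OF x ab(2)] d by simp_all
  note s' = s[folded f]
  obtain p where p: "path_homotopic ?X ?a ?b p p" "path_homotopic ?Y (?f ?a) (?f ?b) (?f \<circ> p) s"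
    using weak_equivalence_top_full[OF w' ab path_homotopic_left[OF s']] .
  have dp: "path_homotopic ?X ?a ?b (realized_dag A x \<circ> p) (realized_dag A x \<circ> p)"
    using path_homotopic_image[OF p(1) A.continuous_realized_dag[OF x]] d by simp
  \<comment> \<open>The images of \<open>p\<close> and of its dagger are both homotopic to \<open>s\<close>, so faithfulness applies.\<close>
  have "path_homotopic ?Y (?f ?a) (?f ?b) (?f \<circ> (realized_dag A x \<circ> p)) (realized_dag B x \<circ> (?f \<circ> p))"
    using realize_F_dag_path[OF x p(1)] d by simp
  also have "path_homotopic ?Y (?f ?a) (?f ?b) \<dots> (realized_dag B x \<circ> s)"
    using path_homotopic_image[OF p(2) B.continuous_realized_dag[OF xB]] dB by simp
  also have "path_homotopic ?Y (?f ?a) (?f ?b) \<dots> s" by (rule path_homotopic_sym[OF s'])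
  also have "path_homotopic ?Y (?f ?a) (?f ?b) \<dots> (?f \<circ> p)" by (rule path_homotopic_sym[OF p(2)])
  finally have "path_homotopic ?X ?a ?b (realized_dag A x \<circ> p) p"
    by (rule weak_equivalence_top_faithful[OF w' dp p(1)])
  then show thesis by (rule that[OF path_homotopic_sym])
qed

end

lemma walk_loop_cancel: "walk 0 0 w \<Longrightarrow> equivclp (cancel 0 0) w []"
proof (induction w rule: length_induct)
  case (1 w)
  show ?case
  proof (cases w)
    case (Cons l v)
    with 1(2) have l: "l = LA" "walk 1 0 v" by (cases l; simp)+
    then obtain m z where v: "v = m # z" by (cases v) auto
    with l have m: "m = LAdag" "walk 0 0 z" by (cases m; simp)+
    have "cancel 0 0 w z"
      unfolding cancel_def using 1(2) m l Cons v
      by (intro conjI exI[of _ "[]"] exI[of _ z]) auto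
    moreover have "equivclp (cancel 0 0) z []" using 1(1) m Cons v by simp
    ultimately show ?thesis by (rule equivclp_trans[OF r_into_equivclp])
  qed simp
qed

lemma II_loops: "maps II 0 0 = discrete_sset {word_class 0 0 []}"
proof -
  have "word_class 0 0 ` {w. walk 0 0 w} = (\<lambda>_. word_class 0 0 []) ` {w. walk 0 0 w}"
    by (rule image_cong[OF refl], rule word_class_eqI[OF walk_loop_cancel]) simp
  moreover have "walk 0 0 []" by simp
  ultimately have "word_class 0 0 ` {w. walk 0 0 w} = {word_class 0 0 []}"
    unfolding image_constant_conv by (metis empty_iff mem_Collect_eq)
  then show ?thesis by (simp add: II_def discrete_dscat_def)
qed

text \<open>The consequence of coherence that the twisted circle violates. All endomorphisms of the object \<open>0\<close>
  in the walking unitary are trivial, so the endomorphism space of \<open>H\<close> is path connected and simply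
  connected. It therefore contains a path from the identity to \<open>h\<^sup>\<dagger> h\<close>, which is homotopic to
  its dagger simply because any two parallel paths are. The image of this path under \<open>\<Phi>\<close> ends at
  \<open>u\<^sup>\<dagger> u\<close> for \<open>u = \<Phi>(h)\<close>, and the end point can be moved to \<open>v\<^sup>\<dagger> v\<close> along a
  self-adjoint path.\<close>

lemma coherent_self_adjoint_path:
  assumes H: "natural_dagger_interval H j p" and Phi: "dagger_functor H B \<Phi>"
    and v: "v \<in> mor B 0 1 0"
    and cls: "pi0_class (maps B 0 1) (\<Phi> 0 1 0 (j 0 1 0 [LA])) = pi0_class (maps B 0 1) v"
  obtains s where "path_homotopic (realization (maps B 0 0)) (vertex_pt (maps B 0 0) (idm B 0))
    (vertex_pt (maps B 0 0) (norm_sq B 0 1 0 v)) s (realized_dag B 0 \<circ> s)"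
proof -
  interpret Phi: dagger_functor H B \<Phi> by (rule Phi)
  interpret j: dagger_functor JJ H j using H by (simp add: natural_dagger_interval_def)
  have objH: "obj H = {0, 1}" using j.obj_eq by (simp add: JJ_def discrete_dscat_def)
  then have o: "0 \<in> obj H" "1 \<in> obj H" "0 \<in> obj B" "1 \<in> obj B" using Phi.obj_eq by auto
  let ?X = "realization (maps H 0 0)" and ?Y = "realization (maps B 0 0)"
  let ?f = "realize_map (maps B 0 0) (\<Phi> 0 0)" and ?p = "realize_map (maps II 0 0) (p 0 0)"
  define h where "h = j 0 1 0 [LA]"
  have "[LA] \<in> mor JJ 0 1 0" by (simp add: JJ_def discrete_dscat_def discrete_sset_def)
  then have h: "h \<in> mor H 0 1 0"
    unfolding h_def by (intro j.F_closed) (auto simp: JJ_def discrete_dscat_def)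
  let ?a = "vertex_pt (maps H 0 0) (idm H 0)" and ?b = "vertex_pt (maps H 0 0) (norm_sq H 0 1 0 h)"
  have w: "weak_equivalence_top ?X (realization (maps II 0 0)) ?p"
    using H o unfolding natural_dagger_interval_def local_weak_equivalence_def weak_equivalence_def by blast
  then have cp: "continuous_map ?X (realization (maps II 0 0)) ?p"
    by (simp add: weak_equivalence_top_def)
  have pt: "?p c = vertex_pt (maps II 0 0) (word_class 0 0 [])" if "c \<in> topspace ?X" for c
    using continuous_map_in_topspace[OF cp that] unfolding II_loops topspace_realization_point by simp
  have ab: "?a \<in> topspace ?X" "?b \<in> topspace ?X"
    using Phi.A.idm_closed o Phi.A.norm_sq_closed h by (auto intro!: vertex_pt_in_realization)
  have "path_component_of (realization (maps II 0 0)) (?p ?a) (?p ?b)"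
    using continuous_map_in_topspace[OF cp ab(1)] pt[OF ab(1)] pt[OF ab(2)]
    by (simp add: path_component_of_refl)
  then obtain g where g: "path_homotopic ?X ?a ?b g g"
    by (rule weak_equivalence_top_path_reflect[OF w ab])
  have d: "realized_dag H 0 ?a = ?a" "realized_dag H 0 ?b = ?b"
    using o h by (simp_all add: Phi.A.realized_dag_vertex_pt Phi.A.dag_idm Phi.A.dag_norm_sq)
  have dg: "path_homotopic ?X ?a ?b (realized_dag H 0 \<circ> g) (realized_dag H 0 \<circ> g)"
    using path_homotopic_image[OF g Phi.A.continuous_realized_dag[OF o(1)]] d by simp
  have in_X: "q t \<in> topspace ?X" if "path_homotopic ?X ?a ?b q q" "t \<in> {0..1}" for q t
    using that continuous_map_in_topspace[of "top_of_set {0..1}" ?X q t]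
    by (auto simp: path_homotopic_refl_iff pathin_def)
  \<comment> \<open>The paths \<open>g\<close> and \<open>g\<^sup>\<dagger>\<close> have the same image, as the target is a point.\<close>
  have "path_homotopic (realization (maps II 0 0)) (?p ?a) (?p ?b) (?p \<circ> g) (?p \<circ> (realized_dag H 0 \<circ> g))"
    by (rule path_homotopic_eq[OF path_homotopic_image[OF g cp]]) (use pt in_X[OF g] in_X[OF dg] in simp)
  then have gd: "path_homotopic ?X ?a ?b g (realized_dag H 0 \<circ> g)"
    by (rule weak_equivalence_top_faithful[OF w g dg])
  have f: "continuous_map ?X ?Y ?f" by (intro continuous_realize_map Phi.F_smap o)
  have fa: "?f ?a = vertex_pt (maps B 0 0) (idm B 0)"
    using o by (simp add: realize_map_vertex_pt Phi.F_smap Phi.F_idm)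
  have fb: "?f ?b = vertex_pt (maps B 0 0) (norm_sq B 0 1 0 (\<Phi> 0 1 0 h))"
    using o h by (simp add: realize_map_vertex_pt Phi.F_smap Phi.F_norm_sq)
  have "path_homotopic ?Y (?f ?a) (?f ?b) (?f \<circ> g) (?f \<circ> (realized_dag H 0 \<circ> g))"
    by (rule path_homotopic_image[OF gd f])
  also have "path_homotopic ?Y (?f ?a) (?f ?b) \<dots> (realized_dag B 0 \<circ> (?f \<circ> g))"
    using Phi.realize_F_dag_path[OF o(1) g] d by simp
  finally have fg: "path_homotopic ?Y (?f ?a) (?f ?b) (?f \<circ> g) (realized_dag B 0 \<circ> (?f \<circ> g))" .
  have "v \<in> pi0_class (maps B 0 1) (\<Phi> 0 1 0 h)" using v unfolding cls h_def by (simp add: pi0_class_def)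
  then obtain q where q: "path_homotopic ?Y (?f ?b) (vertex_pt (maps B 0 0) (norm_sq B 0 1 0 v)) q q"
      "realized_dag B 0 \<circ> q = q"
    unfolding fb
    using Phi.B.self_adjoint_path_norm_sq[OF o(3,4) Phi.F_closed[OF o(1,2) h]] by blast
  have "path_homotopic ?Y (?f ?a) (vertex_pt (maps B 0 0) (norm_sq B 0 1 0 v))
      (path_join (?f \<circ> g) q) (realized_dag B 0 \<circ> path_join (?f \<circ> g) q)"
    unfolding image_path_join q(2) by (rule path_homotopic_join[OF fg q(1)])
  then show thesis by (rule that[unfolded fa[symmetric]])
qed


section \<open>Evaluation on the realized singular complex\<close>

text \<open>The counit \<open>|Sing T| \<rightarrow> T\<close>, sending the class of a singular simplex \<open>s\<close> and a point \<open>t\<close> to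
  \<open>s(t)\<close>. The chosen representative does not matter, because restricting a singular simplex along
  a map of simplices is composition with that map.\<close>

definition sing_eval :: "(((nat \<Rightarrow> real) \<Rightarrow> 'g) \<Rightarrow> 'u) \<Rightarrow> (nat \<times> 'u \<times> (nat \<Rightarrow> real)) set \<Rightarrow> 'g" where
  "sing_eval \<iota> c = (case SOME p. p \<in> c of (n, s, t) \<Rightarrow> inv_into UNIV \<iota> s t)"

lemma relabel_sing_maps:
  assumes "inj \<iota>"
  shows "simplices (maps (relabel \<iota> (sing_dscat T mul e d)) x y) n = \<iota> ` simplices (sing T) n"
    "act (maps (relabel \<iota> (sing_dscat T mul e d)) x y) m n \<alpha> (\<iota> s) = \<iota> (act (sing T) m n \<alpha> s)"
  using assms by (simp_all add: relabel_def sing_dscat_def)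

lemma sing_eval_real_pt:
  assumes \<iota>: "inj \<iota>"
  shows "sing_eval \<iota> (real_pt (maps (relabel \<iota> (sing_dscat T mul e d)) x y) (n, \<iota> s, t)) = s t"
proof -
  let ?X = "maps (relabel \<iota> (sing_dscat T mul e d)) x y" and ?F = "\<lambda>(n, s, t). inv_into UNIV \<iota> s t"
  have inv: "?F p = ?F q" if glue: "glue ?X p q" for p q
  proof -
    obtain m n \<alpha> s t where *: "s \<in> simplices (sing T) n" "t \<in> standard_simplex m"
        "p = (m, act ?X m n \<alpha> (\<iota> s), t)" "q = (n, \<iota> s, push_coords m \<alpha> t)"
      using glue unfolding glue_def relabel_sing_maps(1)[OF \<iota>] by blast
    then show ?thesis by (simp add: relabel_sing_maps[OF \<iota>] \<iota>) (simp add: sing_def)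
  qed
  have "(SOME p. p \<in> real_pt ?X (n, \<iota> s, t)) \<in> real_pt ?X (n, \<iota> s, t)"
    by (rule someI[of "\<lambda>p. p \<in> real_pt ?X (n, \<iota> s, t)", OF real_pt_self])
  from glue_invariant[of ?X ?F, OF inv this] show ?thesis
    by (simp add: sing_eval_def \<iota>)
qed

lemma continuous_sing_eval:
  assumes \<iota>: "inj \<iota>"
  shows "continuous_map (realization (maps (relabel \<iota> (sing_dscat T mul e d)) x y)) T (sing_eval \<iota>)"
proof (rule continuous_map_from_realization)
  fix n s assume "s \<in> mor (relabel \<iota> (sing_dscat T mul e d)) x y n"
  then obtain f where f: "s = \<iota> f" "f \<in> simplices (sing T) n"
    unfolding relabel_sing_maps(1)[OF \<iota>] by blast
  then have "continuous_map (simplex_top n) T f"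
    by (simp add: sing_def singular_simplex_def simplex_top_def)
  then show "continuous_map (simplex_top n) T
      (\<lambda>t. sing_eval \<iota> (real_pt (maps (relabel \<iota> (sing_dscat T mul e d)) x y) (n, s, t)))"
    by (simp add: f(1) sing_eval_real_pt[OF \<iota>] eta_contract_eq)
qed

lemma sing_eval_realized_dag:
  assumes \<iota>: "inj \<iota>" and C: "dagger_scat (sing_dscat T mul e d)"
    and c: "c \<in> topspace (realization (maps (relabel \<iota> (sing_dscat T mul e d)) () ()))"
  shows "sing_eval \<iota> (realized_dag (relabel \<iota> (sing_dscat T mul e d)) () c) = d (sing_eval \<iota> c)"
proof -
  let ?C = "relabel \<iota> (sing_dscat T mul e d)"
  interpret dagger_scat ?C by (rule relabel_dagger_scat[OF \<iota> C])
  have o: "() \<in> obj ?C" by (simp add: relabel_def sing_dscat_def)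
  obtain n f t where c: "c = real_pt (maps ?C () ()) (n, \<iota> f, t)" "t \<in> standard_simplex n"
    using c unfolding topspace_realization topspace_cells_top relabel_sing_maps(1)[OF \<iota>] by blast
  have "dag ?C () () n (\<iota> f) = \<iota> (\<lambda>t\<in>standard_simplex n. d (f t))"
    using \<iota> by (simp add: relabel_def sing_dscat_def)
  then show ?thesis
    unfolding c(1) realized_dag_def realize_map_real_pt[OF dag_smap[OF o o]]
    by (simp add: sing_eval_real_pt[OF \<iota>] c(2))
qed

lemma sing_eval_vertex_pt:
  assumes "inj \<iota>"
  shows "sing_eval \<iota> (vertex_pt (maps (relabel \<iota> (sing_dscat T mul e d)) x y) (\<iota> (sing_point g))) = g"
  by (simp add: vertex_pt_def sing_eval_real_pt[OF assms]) (simp add: sing_point_def standard_simplex_0)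


section \<open>Paths in the twisted circle\<close>

text \<open>Conjugation negates the real part of the winding number, so a path homotopic to its conjugate has
  imaginary winding number. Its end points then differ by the positive real factor \<open>exp (2 \<pi> i w)\<close>,
  which cannot be \<open>-1\<close>.\<close>

lemma no_conjugation_invariant_path:
  "\<not> path_homotopic (top_of_set (sphere 0 1)) (1 :: complex) (- 1) p (cnj \<circ> p)"
proof
  assume h: "path_homotopic (top_of_set (sphere 0 1)) 1 (- 1) p (cnj \<circ> p)"
  have "path_homotopic (top_of_set (- {0})) (id 1) (id (- 1)) (id \<circ> p) (id \<circ> (cnj \<circ> p))"
    by (rule path_homotopic_image[OF h]) auto
  then have h0: "path_homotopic (top_of_set (- {0})) 1 (- 1) p (cnj \<circ> p)" by simp
  then have ends: "pathin (top_of_set (- {0})) p" "pathstart p = 1" "pathfinish p = - 1"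
    using path_homotopic_left[OF h0] by (auto simp: path_homotopic_refl_iff pathstart_def pathfinish_def)
  then have "homotopic_paths (- {0}) p (cnj \<circ> p)"
    using h0 unfolding homotopic_paths_def path_homotopic_def by (simp add: pathstart_def pathfinish_def)
  then have "winding_number p 0 = winding_number (cnj \<circ> p) 0"
    by (rule winding_number_homotopic_paths)
  moreover have p: "path p" "0 \<notin> path_image p"
    using ends(1) by (auto simp: pathin_def path_def path_image_def)
  ultimately have "winding_number p 0 = - cnj (winding_number p 0)"
    using winding_number_cnj[OF p] by simp
  then have "Re (winding_number p 0) = 0" by (simp add: complex_eq_iff)
  then have w: "2 * pi * \<i> * winding_number p 0 = of_real (- 2 * pi * Im (winding_number p 0))"
    by (simp add: complex_eq_iff)
  have "- 1 = complex_of_real (exp (- 2 * pi * Im (winding_number p 0)))"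
    using winding_number_exp_2pi[OF p] unfolding ends(2,3) w exp_of_real diff_0_right mult_1_right .
  then have "- 1 = exp (- 2 * pi * Im (winding_number p 0))"
    using of_real_eq_iff[of "- 1" "exp (- 2 * pi * Im (winding_number p 0))", where 'a = complex]
    unfolding of_real_minus of_real_1 by blast
  moreover have "0 < exp (- 2 * pi * Im (winding_number p 0))" by (rule exp_gt_zero)
  ultimately show False by linarith
qed

lemma path_homotopic_G_top_snd:
  assumes "path_homotopic G_top (1, 1) b p p" "t \<in> {0..1}"
  shows "snd (p t) = 1"
proof -
  have p: "continuous_map (top_of_set {0..1}) G_top p" "p 0 = (1, 1)"
    using assms(1) by (auto simp: path_homotopic_refl_iff pathin_def)
  have "continuous_map G_top (discrete_topology {1, omega}) snd"
    unfolding G_top_def by (rule continuous_map_snd)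
  from continuous_map_compose[OF p(1) this]
  have "connectedin (discrete_topology {1, omega}) ((snd \<circ> p) ` {0..1})"
    by (rule connectedin_continuous_map_image) (simp add: connectedin_subtopology)
  then obtain c where "(snd \<circ> p) ` {0..1} \<subseteq> {c}"
    unfolding connectedin_discrete_topology by blast
  then have "(snd \<circ> p) t = (snd \<circ> p) 0" using assms(2) by (auto simp: image_subset_iff)
  then show ?thesis using p(2) by simp
qed

text \<open>A path starting at the unit stays in the identity component, where the dagger is complex
  conjugation on the circle.\<close>

lemma no_self_adjoint_path_G_top:
  "\<not> path_homotopic G_top (1, 1) (- 1, 1) p ((\<lambda>g. theta (G_inv g)) \<circ> p)"
proof
  assume h: "path_homotopic G_top (1, 1) (- 1, 1) p ((\<lambda>g. theta (G_inv g)) \<circ> p)"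
  let ?q = "fst \<circ> p"
  have f: "continuous_map G_top (top_of_set (sphere 0 1)) fst"
    unfolding G_top_def by (rule continuous_map_fst)
  have q: "path_homotopic (top_of_set (sphere 0 1)) 1 (- 1) ?q (fst \<circ> ((\<lambda>g. theta (G_inv g)) \<circ> p))"
    using path_homotopic_image[OF h f] by simp
  have "(fst \<circ> ((\<lambda>g. theta (G_inv g)) \<circ> p)) t = (cnj \<circ> ?q) t" if t: "t \<in> {0..1}" for t
  proof -
    have "snd (p t) = 1" by (rule path_homotopic_G_top_snd[OF path_homotopic_left[OF h] t])
    moreover have "continuous_map (top_of_set {0..1}) (top_of_set (sphere 0 1)) ?q"
      using path_homotopic_left[OF q] by (simp add: path_homotopic_refl_iff pathin_def)
    then have "?q t \<in> topspace (top_of_set (sphere 0 1))"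
      by (rule continuous_map_in_topspace) (use t in simp)
    then have "inverse (fst (p t)) = cnj (fst (p t))"
      using divide_conv_cnj[of "fst (p t)" 1] by (simp add: inverse_eq_divide)
    ultimately show ?thesis by (simp add: theta_def G_inv_def omega_def)
  qed
  then have "path_homotopic (top_of_set (sphere 0 1)) 1 (- 1) ?q (cnj \<circ> ?q)"
    using path_homotopic_trans[OF q path_homotopic_eq[OF path_homotopic_left[OF path_homotopic_sym[OF q]]]] by blast
  then show False using no_conjugation_invariant_path by blast
qed


section \<open>The homotopy category\<close>

lemma pi0_class_eqI:
  assumes "t \<in> pi0_class X s"
  shows "pi0_class X t = pi0_class X s"
proof -
  let ?R = "\<lambda>a b. \<exists>e\<in>simplices X 1.
      a = act X 0 1 (const_op 0 0) e \<and> b = act X 0 1 (const_op 0 1) e"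
  have "equivclp ?R s t" using assms by (simp add: pi0_class_def)
  then have "equivclp ?R t x \<longleftrightarrow> equivclp ?R s x" for x
    using equivclp_sym equivclp_trans by (metis (no_types, lifting))
  then show ?thesis by (simp add: pi0_class_def)
qed

lemma pi0_class_edge:
  assumes "simplicial_set X" "e \<in> simplices X 1"
  shows "pi0_class X (act X 0 1 (const_op 0 1) e) = pi0_class X (act X 0 1 (const_op 0 0) e)"
proof (rule pi0_class_eqI)
  have "act X 0 1 (const_op 0 1) e \<in> simplices X 0"
    by (rule simplicial_set.act_closed[OF assms(1) const_op_Delta assms(2)]) simp
  then show "act X 0 1 (const_op 0 1) e \<in> pi0_class X (act X 0 1 (const_op 0 0) e)"
    unfolding pi0_class_def using assms(2) by (auto intro!: r_into_equivclp)
qed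

text \<open>The hypothesis speaks of vertices and edges only, so that \<open>f\<close> can be composition with a fixed
  vertex, which acts on edges after that vertex has been degenerated.\<close>

lemma pi0_class_map:
  assumes Y: "simplicial_set Y" and t: "t \<in> pi0_class X s"
    and edge: "\<And>e. e \<in> simplices X 1 \<Longrightarrow> \<exists>e'\<in>simplices Y 1. \<forall>i\<le>1.
      f (act X 0 1 (const_op 0 i) e) = act Y 0 1 (const_op 0 i) e'"
  shows "pi0_class Y (f t) = pi0_class Y (f s)"
proof -
  have 1: "pi0_class Y (f (act X 0 1 (const_op 0 1) e)) = pi0_class Y (f (act X 0 1 (const_op 0 0) e))"
    if "e \<in> simplices X 1" for e
    using edge[OF that] pi0_class_edge[OF Y] by auto
  have "equivclp (\<lambda>a b. \<exists>e\<in>simplices X 1.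
      a = act X 0 1 (const_op 0 0) e \<and> b = act X 0 1 (const_op 0 1) e) s t"
    using t by (simp add: pi0_class_def)
  then show ?thesis by (induction rule: equivclp_induct) (use 1 in auto)
qed

lemma pi0_class_self: "s \<in> simplices X 0 \<Longrightarrow> s \<in> pi0_class X s"
  by (simp add: pi0_class_def)

lemma (in simplicial_set) degenerate_edge:
  assumes s: "s \<in> simplices X 0" and i: "i \<le> 1"
  shows "act X 1 0 (const_op 1 0) s \<in> simplices X 1"
    "act X 0 1 (const_op 0 i) (act X 1 0 (const_op 1 0) s) = s"
proof -
  have d: "const_op 1 0 \<in> Delta 1 0" "const_op 0 i \<in> Delta 0 1" using i by (simp_all add: const_op_Delta)
  show "act X 1 0 (const_op 1 0) s \<in> simplices X 1" by (rule act_closed[OF d(1) s])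
  have "compose {..0} (const_op 1 0) (const_op 0 i) = (\<lambda>i\<in>{..0}. i)"
    using i by (auto simp: compose_def const_op_def)
  then show "act X 0 1 (const_op 0 i) (act X 1 0 (const_op 1 0) s) = s"
    using act_compose[OF d s] act_id[OF s] by simp
qed

context dagger_scat
begin

lemma ho_dag_class:
  assumes o: "x \<in> obj C" "y \<in> obj C" and u: "u \<in> mor C x y 0"
  shows "ho_dag C x y (pi0_class (maps C x y) u) = pi0_class (maps C y x) (dag C x y 0 u)"
proof -
  have "pi0_class (maps C y x) (dag C x y 0 v) = pi0_class (maps C y x) (dag C x y 0 u)"
    if "v \<in> pi0_class (maps C x y) u" for v
  proof (rule pi0_class_map[OF maps_sset[OF o(2,1)] that])
    fix e assume e: "e \<in> mor C x y 1"
    show "\<exists>e'\<in>mor C y x 1. \<forall>i\<le>1. dag C x y 0 (act (maps C x y) 0 1 (const_op 0 i) e)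
        = act (maps C y x) 0 1 (const_op 0 i) e'"
      using dag_closed[OF o e] dag_act[OF o const_op_Delta e] by blast
  qed
  then show ?thesis unfolding ho_dag_def using pi0_class_self[OF u] by blast
qed

lemma ho_cmp_class:
  assumes o: "x \<in> obj C" "y \<in> obj C" "z \<in> obj C" and g: "g \<in> mor C y z 0" and f: "f \<in> mor C x y 0"
  shows "ho_cmp C x y z (pi0_class (maps C y z) g) (pi0_class (maps C x y) f)
    = pi0_class (maps C x z) (cmp C x y z 0 g f)"
proof -
  interpret YZ: simplicial_set "maps C y z" by (rule maps_sset[OF o(2,3)])
  interpret XY: simplicial_set "maps C x y" by (rule maps_sset[OF o(1,2)])
  have "pi0_class (maps C x z) (cmp C x y z 0 g' f') = pi0_class (maps C x z) (cmp C x y z 0 g f)"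
    if g': "g' \<in> pi0_class (maps C y z) g" and f': "f' \<in> pi0_class (maps C x y) f" for g' f'
  proof -
    have f'0: "f' \<in> mor C x y 0" using f' by (simp add: pi0_class_def)
    have "pi0_class (maps C x z) (cmp C x y z 0 g' f') = pi0_class (maps C x z) (cmp C x y z 0 g f')"
    proof (rule pi0_class_map[OF maps_sset[OF o(1,3)] g'])
      fix e assume e: "e \<in> mor C y z 1"
      let ?e = "cmp C x y z 1 e (act (maps C x y) 1 0 (const_op 1 0) f')"
      have "?e \<in> mor C x z 1" by (rule cmp_closed[OF o e XY.degenerate_edge(1)[OF f'0 le0]])
      moreover have "cmp C x y z 0 (act (maps C y z) 0 1 (const_op 0 i) e) f' = act (maps C x z) 0 1 (const_op 0 i) ?e"
        if "i \<le> 1" for i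
        using cmp_act[OF o const_op_Delta[OF that] e XY.degenerate_edge(1)[OF f'0 that]]
          XY.degenerate_edge(2)[OF f'0 that] by simp
      ultimately show "\<exists>e'\<in>mor C x z 1. \<forall>i\<le>1. cmp C x y z 0 (act (maps C y z) 0 1 (const_op 0 i) e) f'
          = act (maps C x z) 0 1 (const_op 0 i) e'" by blast
    qed
    also have "\<dots> = pi0_class (maps C x z) (cmp C x y z 0 g f)"
    proof (rule pi0_class_map[OF maps_sset[OF o(1,3)] f'])
      fix e assume e: "e \<in> mor C x y 1"
      let ?e = "cmp C x y z 1 (act (maps C y z) 1 0 (const_op 1 0) g) e"
      have "?e \<in> mor C x z 1" by (rule cmp_closed[OF o YZ.degenerate_edge(1)[OF g le0] e])
      moreover have "cmp C x y z 0 g (act (maps C x y) 0 1 (const_op 0 i) e) = act (maps C x z) 0 1 (const_op 0 i) ?e"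
        if "i \<le> 1" for i
        using cmp_act[OF o const_op_Delta[OF that] YZ.degenerate_edge(1)[OF g that] e]
          YZ.degenerate_edge(2)[OF g that] by simp
      ultimately show "\<exists>e'\<in>mor C x z 1. \<forall>i\<le>1. cmp C x y z 0 g (act (maps C x y) 0 1 (const_op 0 i) e)
          = act (maps C x z) 0 1 (const_op 0 i) e'" by blast
    qed
    finally show ?thesis .
  qed
  then show ?thesis unfolding ho_cmp_def using pi0_class_self[OF f] pi0_class_self[OF g] by blast
qed

lemma weakly_unitaryI:
  assumes o: "x \<in> obj C" "y \<in> obj C" and u: "u \<in> mor C x y 0"
    and "pi0_class (maps C x x) (cmp C x y x 0 (dag C x y 0 u) u) = pi0_class (maps C x x) (idm C x)"
    and "pi0_class (maps C y y) (cmp C y x y 0 u (dag C x y 0 u)) = pi0_class (maps C y y) (idm C y)"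
  shows "weakly_unitary C x y u"
  unfolding weakly_unitary_def ho_inverse_def
  using assms ho_dag_class[OF o u] ho_cmp_class dag_closed[OF o u]
  by (auto simp: pi0_def ho_id_def)

end


section \<open>The counterexample\<close>

text \<open>The edge is the upper half circle. It joins \<open>u\<^sup>\<dagger> u = (-1, 1)\<close> to the unit.\<close>

lemma twisted_circle_semicircle:
  "pi0_class (sing G_top) (sing_point (- 1, 1)) = pi0_class (sing G_top) (sing_point (1, 1))"
proof -
  let ?e = "\<lambda>t\<in>standard_simplex 1. (cis (pi * t 1), 1 :: int)"
  have "continuous_map (simplex_top 1) euclidean (\<lambda>t. pi * t 1)"
    unfolding simplex_top_def
    by (intro continuous_map_real_mult continuous_map_from_subtopology continuous_map_product_projection) auto
  moreover have "continuous_map euclidean (top_of_set (sphere 0 1)) cis"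
    by (auto simp: continuous_map_in_subtopology intro!: continuous_intros)
  ultimately have "continuous_map (simplex_top 1) (top_of_set (sphere 0 1)) (cis \<circ> (\<lambda>t. pi * t 1))"
    by (rule continuous_map_compose)
  then have "continuous_map (simplex_top 1) G_top (\<lambda>t. (cis (pi * t 1), 1))"
    unfolding G_top_def by (intro continuous_map_pairedI) (auto simp: o_def)
  then have "continuous_map (simplex_top 1) G_top ?e"
    by (rule continuous_map_eq) (simp add: simplex_top_def topspace_standard_simplex)
  then have e: "?e \<in> simplices (sing G_top) 1"
    by (simp add: sing_def singular_simplex_def simplex_top_def)
  have "(\<lambda>j. if j = i then 1 else 0) \<in> standard_simplex 1" if "i \<le> 1" for i :: nat
    using that by (auto simp: standard_simplex_def)
  then have face: "act (sing G_top) 0 1 (const_op 0 i) ?e = sing_point (cis (pi * (if 1 = i then 1 else 0)), 1)"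
    if "i \<le> 1" for i
    using that by (auto simp: sing_def sing_point_def push_coords_vertex fun_eq_iff)
  show ?thesis
    using pi0_class_edge[OF sing_simplicial_set e] face[of 0] face[of 1] by simp
qed


lemma G_top_point:
  "z \<in> sphere 0 1 \<Longrightarrow> w \<in> {1, omega} \<Longrightarrow> sing_point (z, w) \<in> simplices (sing G_top) 0"
  by (auto simp: sing_def singular_simplex_def sing_point_def G_top_def intro!: continuous_map_eq[of _ _ "\<lambda>_. (z, w)"])

theorem proposition2p3p15:
  fixes \<iota> :: "((nat \<Rightarrow> real) \<Rightarrow> complex \<times> int) \<Rightarrow> 'u"
    and R :: "(nat, 'u) dscat \<Rightarrow> (nat, 'u) dscat"
    and Rm :: "(nat, 'u) dscat \<Rightarrow> (nat, 'u) dscat \<Rightarrow> (nat, 'u, 'u) dmor \<Rightarrow> (nat, 'u, 'u) dmor"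
    and r :: "(nat, 'u) dscat \<Rightarrow> (nat, 'u, 'u) dmor"
  assumes "inj \<iota>"
    and "functorial_fibrant_replacement {0, 1} R Rm r"
  shows "weakly_unitary (relabel \<iota> twisted_circle) () () (\<iota> (sing_point (1, omega)))
    \<and> \<not> coherently_unitary R r (relabel \<iota> twisted_circle) () () (\<iota> (sing_point (1, omega)))"
proof
  note \<iota> = assms(1)
  let ?C = "relabel \<iota> twisted_circle" and ?u = "\<iota> (sing_point (1, omega))"
  let ?X = "maps ?C () ()"
  interpret C: dagger_scat ?C by (rule relabel_dagger_scat[OF \<iota> twisted_circle_dagger_scat])
  have o: "() \<in> obj ?C" by (simp add: relabel_def twisted_circle_def sing_dscat_def)
  have u: "?u \<in> mor ?C () () 0"
    unfolding twisted_circle_def relabel_sing_maps(1)[OF \<iota>] by (intro imageI G_top_point) auto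
  have uu: "cmp ?C () () () 0 (dag ?C () () 0 ?u) ?u = \<iota> (sing_point (- 1, 1))"
    "cmp ?C () () () 0 ?u (dag ?C () () 0 ?u) = \<iota> (sing_point (- 1, 1))"
    using \<iota> by (auto simp: relabel_def twisted_circle_def sing_dscat_def sing_point_def G_mul_def
        G_inv_def theta_def omega_def intro!: arg_cong[of _ _ \<iota>])
  have id: "idm ?C () = \<iota> (sing_point (1, 1))"
    by (simp add: relabel_def twisted_circle_def sing_dscat_def G_one_def)
  show "weakly_unitary ?C () () ?u"
  proof -
    have "sing_point (- 1, 1) \<in> pi0_class (sing G_top) (sing_point (1, 1))"
      using pi0_class_self[OF G_top_point[of "- 1" 1]] twisted_circle_semicircle by simp
    then have "pi0_class ?X (\<iota> (sing_point (- 1, 1))) = pi0_class ?X (\<iota> (sing_point (1, 1)))"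
    proof (rule pi0_class_map[OF C.maps_sset[OF o o]])
      fix e assume "e \<in> simplices (sing G_top) 1"
      then show "\<exists>e'\<in>simplices ?X 1. \<forall>i\<le>1. \<iota> (act (sing G_top) 0 1 (const_op 0 i) e) = act ?X 0 1 (const_op 0 i) e'"
        unfolding twisted_circle_def by (intro bexI[of _ "\<iota> e"]) (simp_all add: relabel_sing_maps[OF \<iota>])
    qed
    then show ?thesis by (intro C.weakly_unitaryI o u) (simp_all only: uu id)
  qed
  show "\<not> coherently_unitary R r ?C () () ?u"
  proof
    assume "coherently_unitary R r ?C () () ?u"
    let ?E = "two_object ?C () ()"
    let ?B = "R ?E"
    from \<open>coherently_unitary R r ?C () () ?u\<close> obtain H :: "(nat, 'u) dscat" and j p \<Phi>
      where H: "natural_dagger_interval H j p" and Phi: "dagger_functor H ?B \<Phi>"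
        and cls: "pi0_class (maps ?B 0 1) (\<Phi> 0 1 0 (j 0 1 0 [LA])) = pi0_class (maps ?B 0 1) (r ?E 0 1 0 ?u)"
      unfolding coherently_unitary_def by (elim conjE exE) (rule that)
    have E: "?E \<in> sCat {0, 1}" by (rule two_object_dagger_scat[OF C.dagger_scat_axioms o o])
    then have lw: "local_weak_equivalence ?E ?B (r ?E)"
      using assms(2) unfolding functorial_fibrant_replacement_def by blast
    interpret r: dagger_functor ?E ?B "r ?E" using lw by (simp add: local_weak_equivalence_def)
    have oE: "0 \<in> obj ?E" "1 \<in> obj ?E" by (simp_all add: two_object_def)
    have E_maps: "maps ?E i k = ?X" "dag ?E i k = dag ?C () ()" "cmp ?E i k l = cmp ?C () () ()"
      "idm ?E i = idm ?C ()" for i k l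
      by (simp_all add: two_object_def)
    have dE: "realized_dag ?E 0 = realized_dag ?C ()" by (simp add: realized_dag_def E_maps)
    have uE: "?u \<in> mor ?E 0 1 0" using u by (simp add: E_maps)
    obtain s where s: "path_homotopic (realization (maps ?B 0 0)) (vertex_pt (maps ?B 0 0) (idm ?B 0))
        (vertex_pt (maps ?B 0 0) (norm_sq ?B 0 1 0 (r ?E 0 1 0 ?u))) s (realized_dag ?B 0 \<circ> s)"
      using coherent_self_adjoint_path[OF H Phi r.F_closed[OF oE uE] cls] .
    have w: "weak_equivalence (maps ?E 0 0) (maps ?B 0 0) (r ?E 0 0)"
      using lw oE by (simp add: local_weak_equivalence_def)
    obtain q where q: "path_homotopic (realization (maps ?E 0 0)) (vertex_pt (maps ?E 0 0) (idm ?E 0))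
        (vertex_pt (maps ?E 0 0) (norm_sq ?E 0 1 0 ?u)) q (realized_dag ?E 0 \<circ> q)"
      using r.lift_self_adjoint_path[OF oE(1) w r.A.idm_closed[OF oE(1)] r.A.dag_idm[OF oE(1)]
          r.A.norm_sq_closed[OF oE uE] r.A.dag_norm_sq[OF oE uE]
          s[folded r.F_idm[OF oE(1)] r.F_norm_sq[OF oE uE]]] .
    have nE: "norm_sq ?E 0 1 0 ?u = \<iota> (sing_point (- 1, 1))"
      by (simp only: norm_sq_def E_maps uu)
    let ?ev = "sing_eval \<iota> :: _ \<Rightarrow> complex \<times> int" and ?d = "\<lambda>g. theta (G_inv g)"
    have q': "path_homotopic (realization ?X) (vertex_pt ?X (\<iota> (sing_point (1, 1))))
        (vertex_pt ?X (\<iota> (sing_point (- 1, 1)))) q (realized_dag ?C () \<circ> q)"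
      using q unfolding nE dE E_maps id .
    have "continuous_map (realization ?X) G_top ?ev"
      unfolding twisted_circle_def by (rule continuous_sing_eval[OF \<iota>])
    from path_homotopic_image[OF q' this]
    have ev: "path_homotopic G_top (1, 1) (- 1, 1) (?ev \<circ> q) (?ev \<circ> (realized_dag ?C () \<circ> q))"
      unfolding twisted_circle_def sing_eval_vertex_pt[OF \<iota>] .
    have "(?ev \<circ> (realized_dag ?C () \<circ> q)) t = (?d \<circ> (?ev \<circ> q)) t" if t: "t \<in> {0..1}" for t
    proof -
      have "continuous_map (top_of_set {0..1}) (realization ?X) q"
        using path_homotopic_left[OF q'] by (simp add: path_homotopic_refl_iff pathin_def)
      then have "q t \<in> topspace (realization ?X)"
        by (rule continuous_map_in_topspace) (use t in simp)
      then show ?thesis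
        using sing_eval_realized_dag[OF \<iota> twisted_circle_dagger_scat[unfolded twisted_circle_def], of "q t"]
        by (simp add: twisted_circle_def)
    qed
    then have "path_homotopic G_top (1, 1) (- 1, 1) (?ev \<circ> q) (?d \<circ> (?ev \<circ> q))"
      by (rule path_homotopic_trans[OF ev path_homotopic_eq[OF path_homotopic_left[OF path_homotopic_sym[OF ev]]]])
    then show False using no_self_adjoint_path_G_top by contradiction
  qed
qed

end
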